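(* Let $\mathsf{C}$ be a small category with pullbacks in which all isomorphisms are identities. Let $\mathcal{S}_{\mathsf{C}}:\Delta^{\mathrm{op}}\to\mathbf{Set}$ be the simplicial set whose $n$-simplices are the $n$-spans in $\mathsf{C}$, and for a $k$-composable pair $(A,B)\in\mathcal{S}_{\mathsf{C}}(m)\times\mathcal{S}_{\mathsf{C}}(n)$ let $A\circ_k B:\mathrm{Sp}_{m+n-k}\to\mathsf{C}$ be the right Kan extension of the induced functor $[A,B]_{\mathrm{Sp}_k}:\mathrm{Sp}_m\amalg_{\mathrm{Sp}_k}\mathrm{Sp}_n\to\mathsf{C}$ along the inclusion $c_{m,k,n}:\mathrm{Sp}_m\amalg_{\mathrm{Sp}_k}\mathrm{Sp}_n\to\mathrm{Sp}_{m+n-k}$. With these definitions, $\mathcal{S}_{\mathsf{C}}$ is a compository.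
   Context: **Simplicial conventions.** $\mathbb{N}$ includes $0$. $\Delta$ is the category of nonempty finite ordinals $[n]=\{0,\dots,n\}$ and order-preserving maps. A simplicial set is a functor $\mathcal{C}:\Delta^{\mathrm{op}}\to\mathbf{Set}$; write $\mathcal{C}(n)=\mathcal{C}([n])$, and for $f:[m]\to[n]$ and $A\in\mathcal{C}(n)$ write $Af:=\mathcal{C}(f)(A)\in\mathcal{C}(m)$. The map $\partial_k:[n-1]\to[n]$ is the injective order-preserving map omitting $k$; $\eta_k:[n+1]\to[n]$ is the surjective order-preserving map hitting $k$ twice. For $k\le n$, $s_k:[k]\to[n]$ is $v\mapsto v$ and $t_k:[k]\to[n]$ is $v\mapsto v+n-k$; the codomain index $n$ is left implicit. **Compositories.** A pair $(A,B)\in\mathcal{C}(m)\times\mathcal{C}(n)$ is $k$-composable ($k\le m,n$) if $At_k=Bs_k$. A compository is a simplicial set $\mathcal{C}$ with an element $A\circ_k B\in\mathcal{C}(m+n-k)$ for every $k\in\mathbb{N}$ and every $k$-composable pair $(A,B)\in\mathcal{C}(m)\times\mathcal{C}(n)$, such that: 1. (Identity) $As_k\circ_k A=A$ and $A\circ_k At_k=A$. And for every $k$-composable $(A,B)\in\mathcal{C}(m)\times\mathcal{C}(n)$: 2. (Back-and-forth) $(A\circ_k B)s_{m+i}\circ_{k+i}B=A\circ_k B$ for $0\le i\le n-k$; $A\circ_{k+j}(A\circ_k B)t_{n+j}=A\circ_k B$ for $0\le j\le m-k$. 3. (Degeneracies) $(A\circ_k B)\eta_i=A\eta_i\circ_k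 B$ for $i\le m-k$; $(A\circ_k B)\eta_i=A\circ_k B\eta_{i-m+k}$ for $i\ge m$; $(A\circ_k B)\eta_i=A\eta_i\circ_{k+1}B\eta_{i-m+k}$ for $m-k\le i\le m$. 4. (Faces) $(A\circ_k B)\partial_i=A\partial_i\circ_k B$ for $i<m-k$; $(A\circ_k B)\partial_i=A\circ_k B\partial_{i-m+k}$ for $i>m$. **Higher spans.** $\mathrm{Sp}_n$ is the poset of pairs $(v,w)\in\mathbb{N}^2$ with $v\le w\le n$, ordered by $(v,w)\le(v',w')$ iff $v\le v'$ and $w'\le w$, regarded as a category. An $n$-span in $\mathsf{C}$ is a functor $\mathrm{Sp}_n\to\mathsf{C}$. An order-preserving $\xi:[n]\to[n']$ induces the functor $\xi^{\mathrm{tw}}:\mathrm{Sp}_n\to\mathrm{Sp}_{n'}$, $(v,w)\mapsto(\xi(v),\xi(w))$, and the simplicial structure of $\mathcal{S}_{\mathsf{C}}$ is $A\xi:=A\circ\xi^{\mathrm{tw}}$. The pushout $\mathrm{Sp}_m\amalg_{\mathrm{Sp}_k}\mathrm{Sp}_n$ is formed along $t_k^{\mathrm{tw}}:\mathrm{Sp}_k\to\mathrm{Sp}_m$ and $s_k^{\mathrm{tw}}:\mathrm{Sp}_k\to\mathrm{Sp}_n$; the functor $c_{m,k,n}$ is induced by $s_m^{\mathrm{tw}}:\mathrm{Sp}_m\to\mathrm{Sp}_{m+n-k}$ and $t_n^{\mathrm{tw}}:\mathrm{Sp}_n\to\mathrm{Sp}_{m+n-k}$ and identifies the pushout with the full subposet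 of those $(v,w)$ with $w\le m$ or $v\ge m-k$. Explicitly, on objects, $$(A\circ_k B)(v,w)=\begin{cases}A(v,w)& w\le m,\\ A(v,m)\times_{B(0,k)}B(0,w-m+k)& v<m-k,\ w>m,\\ B(v-m+k,w-m+k)& v\ge m-k,\end{cases}$$ with the evident morphisms. Since all isomorphisms in $\mathsf{C}$ are identities, pullbacks and this Kan extension are strictly unique. *)

theory Defs
  imports Main "HOL-Library.FuncSet"
begin

section \<open>Categories\<close>

text \<open>
  A category has an explicit set of objects and an explicit set of arrows, both living in types;
  every category here is therefore small. The composite \<open>Comp C g f\<close> is ``\<open>g\<close> after \<open>f\<close>'', and it
  is only specified for \<open>Dom C g = Cod C f\<close>.
\<close>

record ('o, 'a) cat =
  Obj :: "'o set"
  Arr :: "'a set"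
  Dom :: "'a \<Rightarrow> 'o"
  Cod :: "'a \<Rightarrow> 'o"
  Id :: "'o \<Rightarrow> 'a"
  Comp :: "'a \<Rightarrow> 'a \<Rightarrow> 'a"

definition hom :: "('o, 'a) cat \<Rightarrow> 'o \<Rightarrow> 'o \<Rightarrow> 'a set" where
  "hom C x y = {f \<in> Arr C. Dom C f = x \<and> Cod C f = y}"

locale category =
  fixes C :: "('o, 'a) cat"
  assumes dom_in_Obj: "f \<in> Arr C \<Longrightarrow> Dom C f \<in> Obj C"
    and cod_in_Obj: "f \<in> Arr C \<Longrightarrow> Cod C f \<in> Obj C"
    and Id_in_hom: "x \<in> Obj C \<Longrightarrow> Id C x \<in> hom C x x"
    and Comp_in_hom: "f \<in> hom C x y \<Longrightarrow> g \<in> hom C y z \<Longrightarrow> Comp C g f \<in> hom C x z"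
    and Comp_Id_left: "f \<in> hom C x y \<Longrightarrow> Comp C (Id C y) f = f"
    and Comp_Id_right: "f \<in> hom C x y \<Longrightarrow> Comp C f (Id C x) = f"
    and Comp_assoc: "f \<in> hom C w x \<Longrightarrow> g \<in> hom C x y \<Longrightarrow> h \<in> hom C y z \<Longrightarrow>
      Comp C h (Comp C g f) = Comp C (Comp C h g) f"

definition iso_arr :: "('o, 'a) cat \<Rightarrow> 'a \<Rightarrow> bool" where
  "iso_arr C f \<longleftrightarrow> f \<in> Arr C \<and>
     (\<exists>g \<in> hom C (Cod C f) (Dom C f).
        Comp C g f = Id C (Dom C f) \<and> Comp C f g = Id C (Cod C f))"

definition isos_are_identities :: "('o, 'a) cat \<Rightarrow> bool" where
  "isos_are_identities C \<longleftrightarrow> (\<forall>f. iso_arr C f \<longrightarrow> (\<exists>x \<in> Obj C. f = Id C x))"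

definition is_pullback ::
  "('o, 'a) cat \<Rightarrow> 'a \<Rightarrow> 'a \<Rightarrow> 'o \<Rightarrow> 'a \<Rightarrow> 'a \<Rightarrow> bool" where
  "is_pullback C f g P p q \<longleftrightarrow>
     P \<in> Obj C \<and> p \<in> hom C P (Dom C f) \<and> q \<in> hom C P (Dom C g) \<and>
     Comp C f p = Comp C g q \<and>
     (\<forall>T \<in> Obj C. \<forall>a \<in> hom C T (Dom C f). \<forall>b \<in> hom C T (Dom C g).
        Comp C f a = Comp C g b \<longrightarrow>
        (\<exists>!u. u \<in> hom C T P \<and> Comp C p u = a \<and> Comp C q u = b))"

definition has_pullbacks :: "('o, 'a) cat \<Rightarrow> bool" where
  "has_pullbacks C \<longleftrightarrow>
     (\<forall>f \<in> Arr C. \<forall>g \<in> Arr C. Cod C f = Cod C g \<longrightarrow> (\<exists>P p q. is_pullback C f g P p q))"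


section \<open>Functors and natural transformations\<close>

text \<open>
  Both components of a functor, and the components of a natural transformation, are required to be
  \<open>undefined\<close> outside the source category, so that HOL equality is equality of functors
  and of natural transformations.
\<close>

record ('o, 'a, 'p, 'b) fct =
  FObj :: "'o \<Rightarrow> 'p"
  FArr :: "'a \<Rightarrow> 'b"

definition functors :: "('o, 'a) cat \<Rightarrow> ('p, 'b) cat \<Rightarrow> ('o, 'a, 'p, 'b) fct set" where
  "functors C D = {F.
     FObj F \<in> Obj C \<rightarrow>\<^sub>E Obj D \<and>
     FArr F \<in> extensional (Arr C) \<and>
     (\<forall>f \<in> Arr C. FArr F f \<in> hom D (FObj F (Dom C f)) (FObj F (Cod C f))) \<and>
     (\<forall>x \<in> Obj C. FArr F (Id C x) = Id D (FObj F x)) \<and>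
     (\<forall>f \<in> Arr C. \<forall>g \<in> Arr C. Dom C g = Cod C f \<longrightarrow>
        FArr F (Comp C g f) = Comp D (FArr F g) (FArr F f))}"

text \<open>The composite ``\<open>G\<close> after \<open>F\<close>'' of functors; \<open>C\<close> is the source category of \<open>F\<close>.\<close>

definition fct_comp ::
  "('o, 'a) cat \<Rightarrow> ('p, 'b, 'q, 'c) fct \<Rightarrow> ('o, 'a, 'p, 'b) fct \<Rightarrow> ('o, 'a, 'q, 'c) fct" where
  "fct_comp C G F =
     \<lparr>FObj = (\<lambda>x\<in>Obj C. FObj G (FObj F x)), FArr = (\<lambda>f\<in>Arr C. FArr G (FArr F f))\<rparr>"

definition nat_trans ::
  "('o, 'a) cat \<Rightarrow> ('p, 'b) cat \<Rightarrow> ('o, 'a, 'p, 'b) fct \<Rightarrow> ('o, 'a, 'p, 'b) fct \<Rightarrow>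
   ('o \<Rightarrow> 'b) set" where
  "nat_trans C D F G = {\<tau>.
     \<tau> \<in> extensional (Obj C) \<and>
     (\<forall>x \<in> Obj C. \<tau> x \<in> hom D (FObj F x) (FObj G x)) \<and>
     (\<forall>f \<in> Arr C. Comp D (\<tau> (Cod C f)) (FArr F f) = Comp D (FArr G f) (\<tau> (Dom C f)))}"

text \<open>
  \<open>(R, \<epsilon>)\<close> is a right Kan extension of \<open>F : C \<rightarrow> E\<close> along \<open>K : C \<rightarrow> D\<close>, where \<open>\<epsilon>\<close> is the counit
  from \<open>R \<circ> K\<close> to \<open>F\<close>.
\<close>

definition is_right_Kan_extension ::
  "('o, 'a) cat \<Rightarrow> ('p, 'b) cat \<Rightarrow> ('q, 'c) cat \<Rightarrow> ('o, 'a, 'p, 'b) fct \<Rightarrow> ('o, 'a, 'q, 'c) fct \<Rightarrow>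
   ('p, 'b, 'q, 'c) fct \<Rightarrow> ('o \<Rightarrow> 'c) \<Rightarrow> bool" where
  "is_right_Kan_extension C D E K F R \<epsilon> \<longleftrightarrow>
     R \<in> functors D E \<and> \<epsilon> \<in> nat_trans C E (fct_comp C R K) F \<and>
     (\<forall>M \<in> functors D E. \<forall>\<mu> \<in> nat_trans C E (fct_comp C M K) F.
        \<exists>!\<delta>. \<delta> \<in> nat_trans D E M R \<and>
             (\<forall>x \<in> Obj C. Comp E (\<epsilon> x) (\<delta> (FObj K x)) = \<mu> x))"


section \<open>Simplicial sets and compositories\<close>

text \<open>
  \<open>simplex_maps m n\<close> is the set of arrows from \<open>[m]\<close> to \<open>[n]\<close> in the simplex category;
  maps are \<open>undefined\<close> outside \<open>{..m}\<close>.
\<close>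

definition simplex_maps :: "nat \<Rightarrow> nat \<Rightarrow> (nat \<Rightarrow> nat) set" where
  "simplex_maps m n = {f \<in> {..m} \<rightarrow>\<^sub>E {..n}. mono_on {..m} f}"

text \<open>
  The codomain index \<open>n\<close> is explicit: \<open>face_map n k\<close> goes from \<open>[n - 1]\<close> to \<open>[n]\<close> (for \<open>n \<ge> 1\<close>),
  \<open>degen_map n k\<close> from \<open>[n + 1]\<close> to \<open>[n]\<close>, and \<open>s_map n k\<close>, \<open>t_map n k\<close> from \<open>[k]\<close> to \<open>[n]\<close>.
\<close>

definition face_map :: "nat \<Rightarrow> nat \<Rightarrow> nat \<Rightarrow> nat" where
  "face_map n k = (\<lambda>v\<in>{..n - 1}. if v < k then v else v + 1)"

definition degen_map :: "nat \<Rightarrow> nat \<Rightarrow> nat \<Rightarrow> nat" where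
  "degen_map n k = (\<lambda>v\<in>{..n + 1}. if v \<le> k then v else v - 1)"

definition s_map :: "nat \<Rightarrow> nat \<Rightarrow> nat \<Rightarrow> nat" where
  "s_map n k = (\<lambda>v\<in>{..k}. v)"

definition t_map :: "nat \<Rightarrow> nat \<Rightarrow> nat \<Rightarrow> nat" where
  "t_map n k = (\<lambda>v\<in>{..k}. v + (n - k))"

text \<open>
  A functor from the opposite of the simplex category to sets, written out: \<open>X n\<close> is the set of
  \<open>n\<close>-simplices, and \<open>act m n f A\<close> is \<open>A f\<close> for \<open>f : [m] \<rightarrow> [n]\<close> and \<open>A \<in> X n\<close>. The sets \<open>X n\<close> share
  one type and need not be disjoint, so operations on simplices take the dimensions as arguments.
\<close>

locale simplicial_set =
  fixes X :: "nat \<Rightarrow> 'x set"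
    and act :: "nat \<Rightarrow> nat \<Rightarrow> (nat \<Rightarrow> nat) \<Rightarrow> 'x \<Rightarrow> 'x"
  assumes act_closed: "f \<in> simplex_maps m n \<Longrightarrow> A \<in> X n \<Longrightarrow> act m n f A \<in> X m"
    and act_id: "A \<in> X n \<Longrightarrow> act n n (\<lambda>v\<in>{..n}. v) A = A"
    and act_compose: "f \<in> simplex_maps l m \<Longrightarrow> g \<in> simplex_maps m n \<Longrightarrow> A \<in> X n \<Longrightarrow>
      act l n (compose {..l} g f) A = act l m f (act m n g A)"

definition composable ::
  "(nat \<Rightarrow> 'x set) \<Rightarrow> (nat \<Rightarrow> nat \<Rightarrow> (nat \<Rightarrow> nat) \<Rightarrow> 'x \<Rightarrow> 'x) \<Rightarrow>
   nat \<Rightarrow> nat \<Rightarrow> nat \<Rightarrow> 'x \<Rightarrow> 'x \<Rightarrow> bool" where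
  "composable X act m k n A B \<longleftrightarrow>
     k \<le> m \<and> k \<le> n \<and> A \<in> X m \<and> B \<in> X n \<and> act k m (t_map m k) A = act k n (s_map n k) B"

text \<open>
  \<open>cmp m k n A B\<close> is the \<open>k\<close>-composite of \<open>A \<in> X m\<close> and \<open>B \<in> X n\<close>; it is only constrained on
  \<open>k\<close>-composable pairs. Indices \<open>i - m + k\<close> are written \<open>i + k - m\<close> because subtraction on \<open>nat\<close>
  truncates and \<open>i < m\<close> is possible.
\<close>

locale compository = simplicial_set X act
  for X :: "nat \<Rightarrow> 'x set"
    and act :: "nat \<Rightarrow> nat \<Rightarrow> (nat \<Rightarrow> nat) \<Rightarrow> 'x \<Rightarrow> 'x" +
  fixes cmp :: "nat \<Rightarrow> nat \<Rightarrow> nat \<Rightarrow> 'x \<Rightarrow> 'x \<Rightarrow> 'x"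
  assumes cmp_closed:
      "composable X act m k n A B \<Longrightarrow> cmp m k n A B \<in> X (m + n - k)"
    and identity_left:
      "k \<le> m \<Longrightarrow> A \<in> X m \<Longrightarrow> cmp k k m (act k m (s_map m k) A) A = A"
    and identity_right:
      "k \<le> m \<Longrightarrow> A \<in> X m \<Longrightarrow> cmp m k k A (act k m (t_map m k) A) = A"
    and back_and_forth_left:
      "composable X act m k n A B \<Longrightarrow> i \<le> n - k \<Longrightarrow>
       cmp (m + i) (k + i) n
         (act (m + i) (m + n - k) (s_map (m + n - k) (m + i)) (cmp m k n A B)) B
       = cmp m k n A B"
    and back_and_forth_right:
      "composable X act m k n A B \<Longrightarrow> j \<le> m - k \<Longrightarrow>
       cmp m (k + j) (n + j) A
         (act (n + j) (m + n - k) (t_map (m + n - k) (n + j)) (cmp m k n A B))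
       = cmp m k n A B"
    and degeneracy_left:
      "composable X act m k n A B \<Longrightarrow> i \<le> m - k \<Longrightarrow>
       act (m + n - k + 1) (m + n - k) (degen_map (m + n - k) i) (cmp m k n A B)
       = cmp (m + 1) k n (act (m + 1) m (degen_map m i) A) B"
    and degeneracy_right:
      "composable X act m k n A B \<Longrightarrow> m \<le> i \<Longrightarrow> i \<le> m + n - k \<Longrightarrow>
       act (m + n - k + 1) (m + n - k) (degen_map (m + n - k) i) (cmp m k n A B)
       = cmp m k (n + 1) A (act (n + 1) n (degen_map n (i + k - m)) B)"
    and degeneracy_middle:
      "composable X act m k n A B \<Longrightarrow> m - k \<le> i \<Longrightarrow> i \<le> m \<Longrightarrow>
       act (m + n - k + 1) (m + n - k) (degen_map (m + n - k) i) (cmp m k n A B)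
       = cmp (m + 1) (k + 1) (n + 1)
           (act (m + 1) m (degen_map m i) A) (act (n + 1) n (degen_map n (i + k - m)) B)"
    and face_left:
      "composable X act m k n A B \<Longrightarrow> i < m - k \<Longrightarrow>
       act (m + n - k - 1) (m + n - k) (face_map (m + n - k) i) (cmp m k n A B)
       = cmp (m - 1) k n (act (m - 1) m (face_map m i) A) B"
    and face_right:
      "composable X act m k n A B \<Longrightarrow> m < i \<Longrightarrow> i \<le> m + n - k \<Longrightarrow>
       act (m + n - k - 1) (m + n - k) (face_map (m + n - k) i) (cmp m k n A B)
       = cmp m k (n - 1) A (act (n - 1) n (face_map n (i + k - m)) B)"


section \<open>Higher spans\<close>

text \<open>The full subposet on \<open>S\<close> of the pairs of naturals, as a category with arrows \<open>(p, q)\<close> for \<open>p \<le> q\<close>.\<close>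

definition interval_le :: "nat \<times> nat \<Rightarrow> nat \<times> nat \<Rightarrow> bool" where
  "interval_le p q \<longleftrightarrow> fst p \<le> fst q \<and> snd q \<le> snd p"

definition interval_cat :: "(nat \<times> nat) set \<Rightarrow> (nat \<times> nat, (nat \<times> nat) \<times> (nat \<times> nat)) cat" where
  "interval_cat S =
     \<lparr>Obj = S, Arr = {(p, q). p \<in> S \<and> q \<in> S \<and> interval_le p q}, Dom = fst, Cod = snd,
      Id = (\<lambda>p. (p, p)), Comp = (\<lambda>g f. (fst f, snd g))\<rparr>"

definition Sp :: "nat \<Rightarrow> (nat \<times> nat, (nat \<times> nat) \<times> (nat \<times> nat)) cat" where
  "Sp n = interval_cat {(v, w). v \<le> w \<and> w \<le> n}"

type_synonym ('o, 'a) span = "(nat \<times> nat, (nat \<times> nat) \<times> (nat \<times> nat), 'o, 'a) fct"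

definition spans :: "('o, 'a) cat \<Rightarrow> nat \<Rightarrow> ('o, 'a) span set" where
  "spans C n = functors (Sp n) C"

definition tw ::
  "nat \<Rightarrow> (nat \<Rightarrow> nat) \<Rightarrow> (nat \<times> nat, (nat \<times> nat) \<times> (nat \<times> nat)) span" where
  "tw m \<xi> =
     \<lparr>FObj = (\<lambda>p\<in>Obj (Sp m). map_prod \<xi> \<xi> p),
      FArr = (\<lambda>a\<in>Arr (Sp m). map_prod (map_prod \<xi> \<xi>) (map_prod \<xi> \<xi>) a)\<rparr>"

definition span_act :: "nat \<Rightarrow> nat \<Rightarrow> (nat \<Rightarrow> nat) \<Rightarrow> ('o, 'a) span \<Rightarrow> ('o, 'a) span" where
  "span_act m n \<xi> A = fct_comp (Sp m) A (tw m \<xi>)"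

text \<open>
  The pushout of \<open>Sp m\<close> and \<open>Sp n\<close> over \<open>Sp k\<close>, realised as a full subposet of \<open>Sp (m + n - k)\<close>,
  with its induced functors \<open>[A, B]\<close> and the inclusion \<open>c\<close> into \<open>Sp (m + n - k)\<close>. That this is the
  pushout, and that \<open>[A, B]\<close> and \<open>c\<close> are the induced functors, is shown in
  \<open>span_pushout_square\<close>, \<open>span_pushout_universal\<close> and \<open>span_incl_legs\<close>.
\<close>

definition span_pushout ::
  "nat \<Rightarrow> nat \<Rightarrow> nat \<Rightarrow> (nat \<times> nat, (nat \<times> nat) \<times> (nat \<times> nat)) cat" where
  "span_pushout m k n =
     interval_cat {(v, w). v \<le> w \<and> w \<le> m + n - k \<and> (w \<le> m \<or> m - k \<le> v)}"

definition span_cotuple ::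
  "nat \<Rightarrow> nat \<Rightarrow> nat \<Rightarrow> ('o, 'a) span \<Rightarrow> ('o, 'a) span \<Rightarrow> ('o, 'a) span" where
  "span_cotuple m k n A B =
     (let sh = map_prod (\<lambda>v. v - (m - k)) (\<lambda>w. w - (m - k)) in
      \<lparr>FObj = (\<lambda>p\<in>Obj (span_pushout m k n). if snd p \<le> m then FObj A p else FObj B (sh p)),
       FArr = (\<lambda>a\<in>Arr (span_pushout m k n).
                 if snd (fst a) \<le> m then FArr A a else FArr B (map_prod sh sh a))\<rparr>)"

definition span_incl ::
  "nat \<Rightarrow> nat \<Rightarrow> nat \<Rightarrow> (nat \<times> nat, (nat \<times> nat) \<times> (nat \<times> nat)) span" where
  "span_incl m k n =
     \<lparr>FObj = (\<lambda>p\<in>Obj (span_pushout m k n). p), FArr = (\<lambda>a\<in>Arr (span_pushout m k n). a)\<rparr>"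

definition is_span_composite ::
  "('o, 'a) cat \<Rightarrow> nat \<Rightarrow> nat \<Rightarrow> nat \<Rightarrow> ('o, 'a) span \<Rightarrow> ('o, 'a) span \<Rightarrow> ('o, 'a) span \<Rightarrow> bool" where
  "is_span_composite C m k n A B R \<longleftrightarrow>
     (\<exists>\<epsilon>. is_right_Kan_extension (span_pushout m k n) (Sp (m + n - k)) C
            (span_incl m k n) (span_cotuple m k n A B) R \<epsilon>)"

definition span_comp ::
  "('o, 'a) cat \<Rightarrow> nat \<Rightarrow> nat \<Rightarrow> nat \<Rightarrow> ('o, 'a) span \<Rightarrow> ('o, 'a) span \<Rightarrow> ('o, 'a) span" where
  "span_comp C m k n A B = (THE R. is_span_composite C m k n A B R)"


section \<open>The pushout property\<close>

lemma Sp_simps [simp]: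
  "Obj (Sp n) = {(v, w). v \<le> w \<and> w \<le> n}"
  "Arr (Sp n) = {(p, q). p \<in> Obj (Sp n) \<and> q \<in> Obj (Sp n) \<and> interval_le p q}"
  "Dom (Sp n) = fst" "Cod (Sp n) = snd" "Id (Sp n) = (\<lambda>p. (p, p))"
  "Comp (Sp n) = (\<lambda>g f. (fst f, snd g))"
  by (simp_all add: Sp_def interval_cat_def)

lemma span_pushout_simps [simp]:
  "Obj (span_pushout m k n) = {(v, w). v \<le> w \<and> w \<le> m + n - k \<and> (w \<le> m \<or> m - k \<le> v)}"
  "Arr (span_pushout m k n) =
     {(p, q). p \<in> Obj (span_pushout m k n) \<and> q \<in> Obj (span_pushout m k n) \<and> interval_le p q}"
  "Dom (span_pushout m k n) = fst" "Cod (span_pushout m k n) = snd"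
  "Id (span_pushout m k n) = (\<lambda>p. (p, p))"
  "Comp (span_pushout m k n) = (\<lambda>g f. (fst f, snd g))"
  by (simp_all add: span_pushout_def interval_cat_def)

lemma category_interval_cat: "category (interval_cat S)"
  by unfold_locales (auto simp: interval_cat_def hom_def interval_le_def)

lemma s_map_in_simplex_maps: "k \<le> n \<Longrightarrow> s_map n k \<in> simplex_maps k n"
  by (auto simp: s_map_def simplex_maps_def mono_on_def)

lemma t_map_in_simplex_maps: "k \<le> n \<Longrightarrow> t_map n k \<in> simplex_maps k n"
  by (auto simp: t_map_def simplex_maps_def mono_on_def)

lemma degen_map_in_simplex_maps: "k \<le> n \<Longrightarrow> degen_map n k \<in> simplex_maps (n + 1) n"
  by (auto simp: degen_map_def simplex_maps_def mono_on_def)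

lemma face_map_in_simplex_maps: "1 \<le> n \<Longrightarrow> k \<le> n \<Longrightarrow> face_map n k \<in> simplex_maps (n - 1) n"
  by (auto simp: face_map_def simplex_maps_def mono_on_def)

lemma tw_apply:
  "v \<le> w \<Longrightarrow> w \<le> m \<Longrightarrow> FObj (tw m \<xi>) (v, w) = (\<xi> v, \<xi> w)"
  "a \<in> Arr (Sp m) \<Longrightarrow> FArr (tw m \<xi>) a = map_prod (map_prod \<xi> \<xi>) (map_prod \<xi> \<xi>) a"
  by (auto simp: tw_def)

lemma tw_in_functors: "\<xi> \<in> simplex_maps m n \<Longrightarrow> tw m \<xi> \<in> functors (Sp m) (Sp n)"
  by (auto simp: tw_def functors_def hom_def interval_le_def simplex_maps_def mono_on_def
      PiE_iff Pi_iff)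

lemma span_pushout_square:
  assumes "k \<le> m" "k \<le> n"
  shows "tw m (s_map (m + n - k) m) \<in> functors (Sp m) (span_pushout m k n)"
    and "tw n (t_map (m + n - k) n) \<in> functors (Sp n) (span_pushout m k n)"
    and "fct_comp (Sp k) (tw m (s_map (m + n - k) m)) (tw k (t_map m k)) =
         fct_comp (Sp k) (tw n (t_map (m + n - k) n)) (tw k (s_map n k))"
proof -
  show "tw m (s_map (m + n - k) m) \<in> functors (Sp m) (span_pushout m k n)"
    using assms
    by (auto simp: tw_def functors_def hom_def interval_le_def s_map_def)
  show "tw n (t_map (m + n - k) n) \<in> functors (Sp n) (span_pushout m k n)"
    using assms
    by (auto simp: tw_def functors_def hom_def interval_le_def t_map_def)
  show "fct_comp (Sp k) (tw m (s_map (m + n - k) m)) (tw k (t_map m k)) =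
        fct_comp (Sp k) (tw n (t_map (m + n - k) n)) (tw k (s_map n k))"
    using assms
    by (auto simp: fct_comp_def tw_def s_map_def t_map_def interval_le_def fun_eq_iff)
qed

lemma span_incl_legs:
  assumes "k \<le> m" "k \<le> n"
  shows "span_incl m k n \<in> functors (span_pushout m k n) (Sp (m + n - k))"
    and "fct_comp (Sp m) (span_incl m k n) (tw m (s_map (m + n - k) m)) =
         tw m (s_map (m + n - k) m)"
    and "fct_comp (Sp n) (span_incl m k n) (tw n (t_map (m + n - k) n)) =
         tw n (t_map (m + n - k) n)"
proof -
  show "span_incl m k n \<in> functors (span_pushout m k n) (Sp (m + n - k))"
    by (auto simp: span_incl_def functors_def hom_def interval_le_def)
  show "fct_comp (Sp m) (span_incl m k n) (tw m (s_map (m + n - k) m)) =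
         tw m (s_map (m + n - k) m)"
    using assms
    by (auto simp: fct_comp_def span_incl_def tw_def s_map_def interval_le_def fun_eq_iff)
  show "fct_comp (Sp n) (span_incl m k n) (tw n (t_map (m + n - k) n)) =
         tw n (t_map (m + n - k) n)"
    using assms
    by (auto simp: fct_comp_def span_incl_def tw_def t_map_def interval_le_def fun_eq_iff)
qed

lemma functorsI:
  assumes "FObj F \<in> extensional (Obj C)" "FArr F \<in> extensional (Arr C)"
    and "\<And>x. x \<in> Obj C \<Longrightarrow> FObj F x \<in> Obj D"
    and "\<And>f. f \<in> Arr C \<Longrightarrow> FArr F f \<in> hom D (FObj F (Dom C f)) (FObj F (Cod C f))"
    and "\<And>x. x \<in> Obj C \<Longrightarrow> FArr F (Id C x) = Id D (FObj F x)"
    and "\<And>f g. f \<in> Arr C \<Longrightarrow> g \<in> Arr C \<Longrightarrow> Dom C g = Cod C f \<Longrightarrow>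
      FArr F (Comp C g f) = Comp D (FArr F g) (FArr F f)"
  shows "F \<in> functors C D"
  using assms unfolding functors_def by (simp add: PiE_iff)

lemma functorsD:
  assumes "F \<in> functors C D"
  shows "x \<in> Obj C \<Longrightarrow> FObj F x \<in> Obj D"
    and "f \<in> Arr C \<Longrightarrow> FArr F f \<in> hom D (FObj F (Dom C f)) (FObj F (Cod C f))"
    and "x \<in> Obj C \<Longrightarrow> FArr F (Id C x) = Id D (FObj F x)"
    and "f \<in> Arr C \<Longrightarrow> g \<in> Arr C \<Longrightarrow> Dom C g = Cod C f \<Longrightarrow>
      FArr F (Comp C g f) = Comp D (FArr F g) (FArr F f)"
  using assms unfolding functors_def by auto

lemma functors_eqI:
  assumes "F \<in> functors C D" "G \<in> functors C D"
    and "\<And>x. x \<in> Obj C \<Longrightarrow> FObj F x = FObj G x" "\<And>f. f \<in> Arr C \<Longrightarrow> FArr F f = FArr G f"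
  shows "F = G"
proof -
  have "FObj F = FObj G"
    using assms(1-3) by (intro PiE_ext[of _ "Obj C" "\<lambda>_. Obj D"]) (auto simp: functors_def)
  moreover have "FArr F = FArr G"
    using assms(1,2,4) by (intro extensionalityI[of _ "Arr C"]) (auto simp: functors_def)
  ultimately show ?thesis
    by simp
qed

lemma span_pushout_universal:
  fixes D :: "('o, 'a) cat"
  assumes comp: "composable (spans D) span_act m k n A B"
  defines "in1 \<equiv> tw m (s_map (m + n - k) m)" and "in2 \<equiv> tw n (t_map (m + n - k) n)"
  shows "span_cotuple m k n A B \<in> functors (span_pushout m k n) D"
    and "fct_comp (Sp m) (span_cotuple m k n A B) in1 = A"
    and "fct_comp (Sp n) (span_cotuple m k n A B) in2 = B"
    and "H \<in> functors (span_pushout m k n) D \<Longrightarrow>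
         fct_comp (Sp m) H in1 = A \<Longrightarrow> fct_comp (Sp n) H in2 = B \<Longrightarrow>
         H = span_cotuple m k n A B"
proof -
  define sh where "sh = map_prod (\<lambda>v. v - (m - k)) (\<lambda>w. w - (m - k))"
  let ?P = "span_pushout m k n"
  let ?H = "span_cotuple m k n A B"
  have kmn: "k \<le> m" "k \<le> n"
    using comp by (auto simp: composable_def)
  have A: "A \<in> functors (Sp m) D" and B: "B \<in> functors (Sp n) D"
    and eq: "fct_comp (Sp k) A (tw k (t_map m k)) = fct_comp (Sp k) B (tw k (s_map n k))"
    using comp by (auto simp: composable_def spans_def span_act_def)
  have eqO: "FObj A (v + (m - k), w + (m - k)) = FObj B (v, w)" if "v \<le> w" "w \<le> k" for v w
    using arg_cong[OF eq, of "\<lambda>F. FObj F (v, w)"] that kmn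
    by (simp add: fct_comp_def tw_def s_map_def t_map_def)
  have eqA: "FArr A ((v + (m - k), w + (m - k)), (v' + (m - k), w' + (m - k)))
               = FArr B ((v, w), (v', w'))"
    if "v \<le> v'" "v' \<le> w'" "w' \<le> w" "w \<le> k" for v w v' w'
    using arg_cong[OF eq, of "\<lambda>F. FArr F ((v, w), (v', w'))"] that kmn
    by (simp add: fct_comp_def tw_def s_map_def t_map_def interval_le_def)
  have HA_obj: "FObj ?H p = FObj A p" if "p \<in> Obj (Sp m)" for p
    using that kmn by (auto simp: span_cotuple_def Let_def)
  have HA_arr: "FArr ?H a = FArr A a" if "a \<in> Arr (Sp m)" for a
    using that kmn by (auto simp: span_cotuple_def Let_def)
  have HB_obj: "FObj ?H (v + (m - k), w + (m - k)) = FObj B (v, w)"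
    if "(v, w) \<in> Obj (Sp n)" for v w
    using that kmn eqO[of v w] by (auto simp: span_cotuple_def Let_def)
  have HB_arr: "FArr ?H ((v + (m - k), w + (m - k)), (v' + (m - k), w' + (m - k)))
                  = FArr B ((v, w), (v', w'))"
    if "((v, w), (v', w')) \<in> Arr (Sp n)" for v w v' w'
    using that kmn eqA[of v v' w' w] by (auto simp: span_cotuple_def Let_def interval_le_def)
  have objE: "p \<in> Obj (Sp m) \<or> (\<exists>v w. p = (v + (m - k), w + (m - k)) \<and> (v, w) \<in> Obj (Sp n))"
    if "p \<in> Obj ?P" for p
  proof (cases "snd p \<le> m")
    case False
    with that kmn show ?thesis
      by (intro disjI2 exI[of _ "fst p - (m - k)"] exI[of _ "snd p - (m - k)"]) auto
  qed (use that in auto)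
  have arrE: "a \<in> Arr (Sp m) \<or> (\<exists>v w v' w'. a = ((v + (m - k), w + (m - k)), (v' + (m - k), w' + (m - k)))
      \<and> ((v, w), (v', w')) \<in> Arr (Sp n))"
    if "a \<in> Arr ?P" for a
  proof -
    obtain v w v' w' where a: "a = ((v, w), (v', w'))"
      by (metis surj_pair)
    have le: "v \<le> w" "w \<le> m + n - k" "w \<le> m \<or> m - k \<le> v" "v \<le> v'" "v' \<le> w'" "w' \<le> w"
      using that unfolding a by (simp_all add: interval_le_def)
    show ?thesis
    proof (cases "w \<le> m")
      case True
      with le show ?thesis
        by (simp add: a interval_le_def)
    next
      case False
      define l where "l = m - k"
      have "l \<le> v" "w \<le> n + l"
        using le False kmn by (auto simp: l_def)
      then obtain x y x' y' where "v = x + l" "w = y + l" "v' = x' + l" "w' = y' + l"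
        using le by (metis le_add_diff_inverse2 order_trans)
      with le \<open>w \<le> n + l\<close> have "a = ((x + l, y + l), (x' + l, y' + l))"
          "((x, y), (x', y')) \<in> Arr (Sp n)"
        by (simp_all add: a interval_le_def)
      then show ?thesis
        unfolding l_def by blast
    qed
  qed
  have FA: "FObj A p \<in> Obj D" if "p \<in> Obj (Sp m)" for p
    using A that by (auto simp: functors_def)
  have FB: "FObj B p \<in> Obj D" if "p \<in> Obj (Sp n)" for p
    using B that by (auto simp: functors_def)
  show H: "?H \<in> functors ?P D"
  proof (rule functorsI)
    show "FObj ?H \<in> extensional (Obj ?P)" "FArr ?H \<in> extensional (Arr ?P)"
      by (simp_all only: span_cotuple_def Let_def fct.simps restrict_extensional)
    show "FObj ?H p \<in> Obj D" if "p \<in> Obj ?P" for p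
      using objE[OF that] HA_obj HB_obj FA FB by metis
  next
    fix a
    assume "a \<in> Arr ?P"
    from arrE[OF this]
    show "FArr ?H a \<in> hom D (FObj ?H (Dom ?P a)) (FObj ?H (Cod ?P a))"
    proof (elim disjE exE conjE)
      assume a: "a \<in> Arr (Sp m)"
      then have "FArr A a \<in> hom D (FObj A (fst a)) (FObj A (snd a))"
        using functorsD(2)[OF A, of a] by (simp only: Sp_simps)
      moreover have "fst a \<in> Obj (Sp m)" "snd a \<in> Obj (Sp m)"
        using a by auto
      ultimately show ?thesis
        by (simp only: span_pushout_simps HA_arr[OF a] HA_obj)
    next
      fix v w v' w'
      assume a: "a = ((v + (m - k), w + (m - k)), (v' + (m - k), w' + (m - k)))"
        and b: "((v, w), (v', w')) \<in> Arr (Sp n)"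
      have "FArr B ((v, w), (v', w')) \<in> hom D (FObj B (v, w)) (FObj B (v', w'))"
        using functorsD(2)[OF B b] by (simp only: Sp_simps fst_conv snd_conv)
      moreover have "(v, w) \<in> Obj (Sp n)" "(v', w') \<in> Obj (Sp n)"
        using b by auto
      ultimately show ?thesis
        by (simp only: span_pushout_simps a fst_conv snd_conv HB_arr[OF b] HB_obj)
    qed
  next
    fix p
    assume "p \<in> Obj ?P"
    from objE[OF this] show "FArr ?H (Id ?P p) = Id D (FObj ?H p)"
    proof (elim disjE exE conjE)
      assume p: "p \<in> Obj (Sp m)"
      then have "FArr A (p, p) = Id D (FObj A p)"
        using functorsD(3)[OF A, of p] by (simp only: Sp_simps)
      moreover have "(p, p) \<in> Arr (Sp m)"
        using p by (simp add: interval_le_def)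
      ultimately show ?thesis
        using HA_arr[of "(p, p)"] HA_obj[OF p] by simp
    next
      fix v w
      assume p: "p = (v + (m - k), w + (m - k))" and q: "(v, w) \<in> Obj (Sp n)"
      from q have "FArr B ((v, w), (v, w)) = Id D (FObj B (v, w))"
        using functorsD(3)[OF B, of "(v, w)"] by (simp only: Sp_simps)
      moreover have "((v, w), (v, w)) \<in> Arr (Sp n)"
        using q by (simp add: interval_le_def)
      ultimately show ?thesis
        using HB_arr[of v w v w] HB_obj[OF q] p by simp
    qed
  next
    fix f g
    assume fg: "f \<in> Arr ?P" "g \<in> Arr ?P" "Dom ?P g = Cod ?P f"
    from arrE[OF fg(1)] show "FArr ?H (Comp ?P g f) = Comp D (FArr ?H g) (FArr ?H f)"
    proof (elim disjE exE conjE)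
      assume f: "f \<in> Arr (Sp m)"
      then have g: "g \<in> Arr (Sp m)" and gf: "(fst f, snd g) \<in> Arr (Sp m)"
        using fg by (auto simp: interval_le_def)
      have "FArr A (fst f, snd g) = Comp D (FArr A g) (FArr A f)"
        using functorsD(4)[OF A f g] fg(3) by (simp only: Sp_simps span_pushout_simps)
      then show ?thesis
        using HA_arr[OF f] HA_arr[OF g] HA_arr[OF gf] by simp
    next
      fix v w v' w'
      assume f: "f = ((v + (m - k), w + (m - k)), (v' + (m - k), w' + (m - k)))"
        and b: "((v, w), (v', w')) \<in> Arr (Sp n)"
      obtain x y where g: "g = ((v' + (m - k), w' + (m - k)), (x, y))"
        using fg(3) f by (cases g) auto
      define v'' w'' where "v'' = x - (m - k)" and "w'' = y - (m - k)"
      have xy: "x = v'' + (m - k)" "y = w'' + (m - k)"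
        using fg(2) g by (auto simp: v''_def w''_def interval_le_def)
      have c: "((v', w'), (v'', w'')) \<in> Arr (Sp n)" and d: "((v, w), (v'', w'')) \<in> Arr (Sp n)"
        using fg(2) b unfolding g xy by (auto simp: interval_le_def)
      have "FArr B ((v, w), (v'', w'')) =
              Comp D (FArr B ((v', w'), (v'', w''))) (FArr B ((v, w), (v', w')))"
        using functorsD(4)[OF B b c] by (simp only: Sp_simps fst_conv snd_conv)
      then show ?thesis
        using HB_arr[OF b] HB_arr[OF c] HB_arr[OF d] unfolding f g xy by simp
    qed
  qed
  have in1: "in1 = \<lparr>FObj = (\<lambda>p\<in>Obj (Sp m). p), FArr = (\<lambda>a\<in>Arr (Sp m). a)\<rparr>"
    by (auto simp: in1_def tw_def s_map_def fun_eq_iff interval_le_def)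
  have in2_obj: "FObj in2 (v, w) = (v + (m - k), w + (m - k))" if "(v, w) \<in> Obj (Sp n)" for v w
    using that kmn by (auto simp: in2_def tw_def t_map_def)
  have in2_arr: "FArr in2 ((v, w), (v', w')) = ((v + (m - k), w + (m - k)), (v' + (m - k), w' + (m - k)))"
    if "((v, w), (v', w')) \<in> Arr (Sp n)" for v w v' w'
    using that kmn by (auto simp: in2_def tw_def t_map_def interval_le_def)
  have comp_in1: "fct_comp (Sp m) G in1 =
      \<lparr>FObj = restrict (FObj G) (Obj (Sp m)), FArr = restrict (FArr G) (Arr (Sp m))\<rparr>" for G :: "('o, 'a) span"
    by (auto simp: fct_comp_def in1 fun_eq_iff)
  have extA: "FObj A \<in> extensional (Obj (Sp m))" "FArr A \<in> extensional (Arr (Sp m))"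
    using A unfolding functors_def PiE_def by blast+
  have extB: "FObj B \<in> extensional (Obj (Sp n))" "FArr B \<in> extensional (Arr (Sp n))"
    using B unfolding functors_def PiE_def by blast+
  have "restrict (FObj ?H) (Obj (Sp m)) = FObj A"
    by (rule extensionalityI[OF restrict_extensional extA(1)]) (simp only: restrict_apply' HA_obj)
  moreover have "restrict (FArr ?H) (Arr (Sp m)) = FArr A"
    by (rule extensionalityI[OF restrict_extensional extA(2)]) (simp only: restrict_apply' HA_arr)
  ultimately show "fct_comp (Sp m) ?H in1 = A"
    by (simp only: comp_in1) simp
  have "FObj (fct_comp (Sp n) ?H in2) = FObj B"
  proof (rule extensionalityI[of _ "Obj (Sp n)"])
    fix p assume "p \<in> Obj (Sp n)"
    then show "FObj (fct_comp (Sp n) ?H in2) p = FObj B p"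
      by (cases p) (simp only: fct_comp_def fct.simps restrict_apply' in2_obj HB_obj)
  qed (use extB in \<open>simp_all only: fct_comp_def fct.simps restrict_extensional\<close>)
  moreover have "FArr (fct_comp (Sp n) ?H in2) = FArr B"
  proof (rule extensionalityI[of _ "Arr (Sp n)"])
    fix a assume a: "a \<in> Arr (Sp n)"
    obtain v w v' w' where "a = ((v, w), (v', w'))"
      by (metis surj_pair)
    with a show "FArr (fct_comp (Sp n) ?H in2) a = FArr B a"
      by (simp only: fct_comp_def fct.simps restrict_apply' in2_arr HB_arr)
  qed (use extB in \<open>simp_all only: fct_comp_def fct.simps restrict_extensional\<close>)
  ultimately show "fct_comp (Sp n) ?H in2 = B"
    by simp
  assume G: "H \<in> functors ?P D" and GA: "fct_comp (Sp m) H in1 = A"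
    and GB: "fct_comp (Sp n) H in2 = B"
  have GA_obj: "FObj H p = FObj A p" if "p \<in> Obj (Sp m)" for p
    using that unfolding GA[symmetric] comp_in1 by (simp only: fct.simps restrict_apply')
  have GA_arr: "FArr H a = FArr A a" if "a \<in> Arr (Sp m)" for a
    using that unfolding GA[symmetric] comp_in1 by (simp only: fct.simps restrict_apply')
  have GB_obj: "FObj H (v + (m - k), w + (m - k)) = FObj B (v, w)"
    if "(v, w) \<in> Obj (Sp n)" for v w
    using that unfolding GB[symmetric]
    by (simp only: fct_comp_def fct.simps restrict_apply' in2_obj)
  have GB_arr: "FArr H ((v + (m - k), w + (m - k)), (v' + (m - k), w' + (m - k)))
                  = FArr B ((v, w), (v', w'))"
    if "((v, w), (v', w')) \<in> Arr (Sp n)" for v w v' w'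
    using that unfolding GB[symmetric]
    by (simp only: fct_comp_def fct.simps restrict_apply' in2_arr)
  show "H = ?H"
  proof (rule functors_eqI[OF G H])
    show "FObj H p = FObj ?H p" if "p \<in> Obj ?P" for p
      using objE[OF that] GA_obj HA_obj GB_obj HB_obj by metis
    show "FArr H a = FArr ?H a" if "a \<in> Arr ?P" for a
      using arrE[OF that] GA_arr HA_arr GB_arr HB_arr by metis
  qed
qed

end

theory Submission
  imports Defs
begin

text \<open>
  Everything rests on one description of composites: a span \<open>R\<close> of dimension \<open>m + n - k\<close> is the
  \<open>k\<close>-composite of its front face \<open>A = R s\<^sub>m\<close> and its back face \<open>B = R t\<^sub>n\<close> exactly when, for
  all \<open>v < m - k\<close> and \<open>w > m\<close>, the square formed by \<open>R (v, w)\<close>, \<open>R (v, m)\<close>, \<open>R (m - k, w)\<close> and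
  \<open>R (m - k, m)\<close> is a pullback. The reason is that right Kan extensions along the inclusion
  of a full subposet are computed by limits: the value at \<open>(v, w)\<close> is the limit of \<open>[A, B]\<close> over the
  members of the pushout above \<open>(v, w)\<close>, and the cospan
  \<open>(v, m) \<rightarrow> (m - k, m) \<leftarrow> (m - k, w)\<close> is initial among these. Pullbacks therefore give existence
  (\<open>pullback_across_exists\<close>, \<open>pullback_across_is_composite\<close>). Two Kan extensions are naturally
  isomorphic, and isomorphisms are identities, so the composite is strictly unique
  (\<open>Kan_extension_unique\<close>).

  By pasting, the composite has more pullback squares than those required: the square with
  corners \<open>(v, w)\<close> and \<open>(v', w')\<close> is a pullback whenever \<open>v \<le> v' \<le> m - k\<close> and \<open>m \<le> w' \<le> w\<close>
  (\<open>span_square_pasting\<close>). Hence, for an order-preserving \<open>\<xi> : [m' + n' - k'] \<rightarrow> [m + n - k]\<close> with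
  \<open>\<xi> (m' - k') \<le> m - k\<close> and \<open>m \<le> \<xi> m'\<close>, the span \<open>R \<xi>\<close> is again a composite, namely the
  \<open>k'\<close>-composite of its own front and back faces (\<open>pullback_across_reindex\<close>). The laws of a compository
  other than the identity laws are instances of this: the back-and-forth laws have \<open>\<xi>\<close> the identity, the
  others have \<open>\<xi>\<close> a degeneracy or a face map, and what remains is to recognise the two faces of \<open>R \<xi>\<close> by
  simplicial identities. In the identity laws no square is required to be a pullback.
\<close>

section \<open>Arrows and pullbacks\<close>

context category
begin

lemma homD: "f \<in> hom C x y \<Longrightarrow> f \<in> Arr C" "f \<in> hom C x y \<Longrightarrow> Dom C f = x"
    "f \<in> hom C x y \<Longrightarrow> Cod C f = y"
  by (auto simp: hom_def)

lemma hom_Obj: "f \<in> hom C x y \<Longrightarrow> x \<in> Obj C" "f \<in> hom C x y \<Longrightarrow> y \<in> Obj C"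
  using dom_in_Obj cod_in_Obj by (auto simp: hom_def)

lemma is_pullback_iff:
  assumes "f \<in> hom C X Z" "g \<in> hom C Y Z"
  shows "is_pullback C f g P p q \<longleftrightarrow>
     p \<in> hom C P X \<and> q \<in> hom C P Y \<and> Comp C f p = Comp C g q \<and>
     (\<forall>T a b. a \<in> hom C T X \<longrightarrow> b \<in> hom C T Y \<longrightarrow> Comp C f a = Comp C g b \<longrightarrow>
        (\<exists>!u. u \<in> hom C T P \<and> Comp C p u = a \<and> Comp C q u = b))"
  using assms hom_Obj unfolding is_pullback_def homD(2)[OF assms(1)] homD(2)[OF assms(2)]
  by blast

lemma pullback_lift:
  assumes "is_pullback C f g P p q" "f \<in> hom C X Z" "g \<in> hom C Y Z"
    and "a \<in> hom C T X" "b \<in> hom C T Y" "Comp C f a = Comp C g b"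
  obtains u where "u \<in> hom C T P" "Comp C p u = a" "Comp C q u = b"
  using assms(1)[unfolded is_pullback_iff[OF assms(2,3)]] assms(4-) by blast

lemma pullback_jointly_monic:
  assumes "is_pullback C f g P p q" "f \<in> hom C X Z" "g \<in> hom C Y Z"
    and u: "u \<in> hom C T P" and u': "u' \<in> hom C T P"
    and eq: "Comp C p u = Comp C p u'" "Comp C q u = Comp C q u'"
  shows "u = u'"
proof -
  note pb = assms(1)[unfolded is_pullback_iff[OF assms(2,3)]]
  have p: "p \<in> hom C P X" and q: "q \<in> hom C P Y" and sq: "Comp C f p = Comp C g q"
    using pb by auto
  have "Comp C f (Comp C p u) = Comp C g (Comp C q u)"
    using Comp_assoc[OF u p assms(2)] Comp_assoc[OF u q assms(3)] sq by simp
  moreover have "Comp C p u \<in> hom C T X" "Comp C q u \<in> hom C T Y"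
    using Comp_in_hom u p q by blast+
  ultimately show ?thesis
    using pb u u' eq by (metis (no_types, lifting))
qed

end


section \<open>Functors on posets of intervals\<close>

lemma interval_cat_simps:
  "Obj (interval_cat S) = S"
  "Arr (interval_cat S) = {(p, q). p \<in> S \<and> q \<in> S \<and> interval_le p q}"
  "Dom (interval_cat S) = fst" "Cod (interval_cat S) = snd"
  "Id (interval_cat S) = (\<lambda>p. (p, p))" "Comp (interval_cat S) = (\<lambda>g f. (fst f, snd g))"
  by (simp_all add: interval_cat_def)

lemma interval_le_refl: "interval_le p p"
  by (simp add: interval_le_def)

lemma interval_le_trans: "interval_le p q \<Longrightarrow> interval_le q r \<Longrightarrow> interval_le p r"
  by (auto simp: interval_le_def)

context category
begin

context
  fixes S and R :: "('o, 'a) span"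
  assumes R: "R \<in> functors (interval_cat S) C"
begin

lemma interval_functor_obj: "x \<in> S \<Longrightarrow> FObj R x \<in> Obj C"
  using functorsD(1)[OF R] by (simp add: interval_cat_simps)

lemma interval_functor_arr:
  "x \<in> S \<Longrightarrow> y \<in> S \<Longrightarrow> interval_le x y \<Longrightarrow> FArr R (x, y) \<in> hom C (FObj R x) (FObj R y)"
  using functorsD(2)[OF R, of "(x, y)"] by (simp add: interval_cat_simps)

lemma interval_functor_id: "x \<in> S \<Longrightarrow> FArr R (x, x) = Id C (FObj R x)"
  using functorsD(3)[OF R, of x] by (simp add: interval_cat_simps)

lemma interval_functor_comp:
  assumes "x \<in> S" "y \<in> S" "z \<in> S" "interval_le x y" "interval_le y z"
  shows "Comp C (FArr R (y, z)) (FArr R (x, y)) = FArr R (x, z)"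
  using functorsD(4)[OF R, of "(x, y)" "(y, z)"] assms by (simp add: interval_cat_simps)

lemma interval_functor_comp_after:
  assumes "x \<in> S" "y \<in> S" "z \<in> S" "interval_le x y" "interval_le y z"
    and "u \<in> hom C T (FObj R x)"
  shows "Comp C (FArr R (y, z)) (Comp C (FArr R (x, y)) u) = Comp C (FArr R (x, z)) u"
  using Comp_assoc[OF assms(6) interval_functor_arr[of x y] interval_functor_arr[of y z]]
    interval_functor_comp[OF assms(1-5)] assms by simp

end

end


section \<open>Pointwise Kan extensions along full subposets\<close>

text \<open>
  A cone with apex \<open>T\<close> on the restriction of \<open>F\<close> to the members of \<open>P\<close> above \<open>x\<close>. As \<open>P\<close> is a full
  subposet, this restriction is the diagram indexed by the comma category of \<open>x\<close> over the inclusion,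
  whose limit is the pointwise right Kan extension at \<open>x\<close>. The values of \<open>\<alpha>\<close> elsewhere are
  arbitrary, which allows a cone above \<open>x\<close> to be reused above any \<open>y\<close> beyond \<open>x\<close>.
\<close>

definition cone_above ::
  "('o, 'a) cat \<Rightarrow> (nat \<times> nat) set \<Rightarrow> ('o, 'a) span \<Rightarrow> nat \<times> nat \<Rightarrow> 'o \<Rightarrow> (nat \<times> nat \<Rightarrow> 'a) \<Rightarrow> bool" where
  "cone_above C P F x T \<alpha> \<longleftrightarrow>
     T \<in> Obj C \<and> (\<forall>z\<in>P. interval_le x z \<longrightarrow> \<alpha> z \<in> hom C T (FObj F z)) \<and>
     (\<forall>z\<in>P. \<forall>z'\<in>P. interval_le x z \<longrightarrow> interval_le z z' \<longrightarrow> Comp C (FArr F (z, z')) (\<alpha> z) = \<alpha> z')"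

definition limit_cone_above ::
  "('o, 'a) cat \<Rightarrow> (nat \<times> nat) set \<Rightarrow> ('o, 'a) span \<Rightarrow> nat \<times> nat \<Rightarrow> 'o \<Rightarrow> (nat \<times> nat \<Rightarrow> 'a) \<Rightarrow> bool" where
  "limit_cone_above C P F x L \<pi> \<longleftrightarrow>
     cone_above C P F x L \<pi> \<and>
     (\<forall>T \<alpha>. cone_above C P F x T \<alpha> \<longrightarrow>
        (\<exists>!u. u \<in> hom C T L \<and> (\<forall>z\<in>P. interval_le x z \<longrightarrow> Comp C (\<pi> z) u = \<alpha> z)))"

definition subposet_incl ::
  "(nat \<times> nat) set \<Rightarrow> (nat \<times> nat, (nat \<times> nat) \<times> (nat \<times> nat)) span" where
  "subposet_incl P = \<lparr>FObj = (\<lambda>p\<in>P. p), FArr = (\<lambda>a\<in>Arr (interval_cat P). a)\<rparr>"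

context category
begin

lemma cone_above_arr: "cone_above C P F x T \<alpha> \<Longrightarrow> z \<in> P \<Longrightarrow> interval_le x z \<Longrightarrow> \<alpha> z \<in> hom C T (FObj F z)"
  and cone_above_comp: "cone_above C P F x T \<alpha> \<Longrightarrow> z \<in> P \<Longrightarrow> z' \<in> P \<Longrightarrow> interval_le x z \<Longrightarrow>
     interval_le z z' \<Longrightarrow> Comp C (FArr F (z, z')) (\<alpha> z) = \<alpha> z'"
  by (auto simp: cone_above_def)

lemma limit_cone_lift:
  assumes "limit_cone_above C P F x L \<pi>" "cone_above C P F x T \<alpha>"
  obtains u where "u \<in> hom C T L" "\<And>z. z \<in> P \<Longrightarrow> interval_le x z \<Longrightarrow> Comp C (\<pi> z) u = \<alpha> z"
  using assms unfolding limit_cone_above_def by blast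

lemma limit_cone_unique:
  assumes "limit_cone_above C P F x L \<pi>" "cone_above C P F x T \<alpha>"
    and "u \<in> hom C T L" "\<And>z. z \<in> P \<Longrightarrow> interval_le x z \<Longrightarrow> Comp C (\<pi> z) u = \<alpha> z"
    and "u' \<in> hom C T L" "\<And>z. z \<in> P \<Longrightarrow> interval_le x z \<Longrightarrow> Comp C (\<pi> z) u' = \<alpha> z"
  shows "u = u'"
  using assms unfolding limit_cone_above_def by blast

text \<open>
  For a member \<open>x\<close> of \<open>P\<close> the index poset has \<open>x\<close> as its least element. This is why the extension
  can be chosen to agree with \<open>F\<close> on \<open>P\<close> on the nose.
\<close>

lemma limit_cone_at_member:
  assumes F: "F \<in> functors (interval_cat P) C" and x: "x \<in> P"
  shows "limit_cone_above C P F x (FObj F x) (\<lambda>z. FArr F (x, z))"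
  unfolding limit_cone_above_def
proof (intro conjI allI impI)
  show "cone_above C P F x (FObj F x) (\<lambda>z. FArr F (x, z))"
    using x interval_functor_obj[OF F] interval_functor_arr[OF F] interval_functor_comp[OF F]
    by (auto simp: cone_above_def)
  fix T \<alpha> assume \<alpha>: "cone_above C P F x T \<alpha>"
  have ax: "\<alpha> x \<in> hom C T (FObj F x)"
    using cone_above_arr[OF \<alpha> x interval_le_refl] .
  show "\<exists>!u. u \<in> hom C T (FObj F x) \<and> (\<forall>z\<in>P. interval_le x z \<longrightarrow> Comp C (FArr F (x, z)) u = \<alpha> z)"
  proof (intro ex1I[of _ "\<alpha> x"] conjI ballI impI)
    fix u assume u: "u \<in> hom C T (FObj F x) \<and> (\<forall>z\<in>P. interval_le x z \<longrightarrow> Comp C (FArr F (x, z)) u = \<alpha> z)"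
    then have "Comp C (FArr F (x, x)) u = \<alpha> x"
      using x interval_le_refl by blast
    then show "u = \<alpha> x"
      using u Comp_Id_left interval_functor_id[OF F x] by metis
  qed (use ax cone_above_comp[OF \<alpha> x _ interval_le_refl] in blast)+
qed

lemma restrict_to_subposet:
  "fct_comp (interval_cat P) R (subposet_incl P) =
    \<lparr>FObj = restrict (FObj R) P, FArr = restrict (FArr R) (Arr (interval_cat P))\<rparr>"
  by (auto simp: fct_comp_def subposet_incl_def interval_cat_simps fun_eq_iff)

text \<open>
  A transformation \<open>\<mu>\<close> from the restriction of \<open>M\<close> to \<open>F\<close> turns each \<open>M x\<close> into a cone above \<open>x\<close>
  with legs \<open>M x \<rightarrow> M z \<rightarrow> F z\<close>. The component at \<open>x\<close> of the required transformation \<open>M \<rightarrow> R\<close> is the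
  map induced by this cone; naturality and uniqueness hold because maps into a limit are
  determined by its legs.
\<close>

lemma pointwise_limits_give_Kan_extension:
  assumes R: "R \<in> functors (interval_cat S) C" and F: "F \<in> functors (interval_cat P) C"
    and PS: "P \<subseteq> S"
    and RF: "fct_comp (interval_cat P) R (subposet_incl P) = F"
    and lim: "\<And>x. x \<in> S \<Longrightarrow> limit_cone_above C P F x (FObj R x) (\<lambda>z. FArr R (x, z))"
  shows "is_right_Kan_extension (interval_cat P) (interval_cat S) C (subposet_incl P) F R
    (\<lambda>z\<in>P. Id C (FObj F z))"
  unfolding is_right_Kan_extension_def
proof (intro conjI ballI)
  show "R \<in> functors (interval_cat S) C" by (fact R)
  have RFo: "FObj F z = FObj R z" if "z \<in> P" for z
    using RF[symmetric] that by (simp add: restrict_to_subposet)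
  show "(\<lambda>z\<in>P. Id C (FObj F z)) \<in> nat_trans (interval_cat P) C
      (fct_comp (interval_cat P) R (subposet_incl P)) F"
    unfolding RF nat_trans_def interval_cat_simps
    using interval_functor_obj[OF F] Id_in_hom
      Comp_Id_left[OF interval_functor_arr[OF F]] Comp_Id_right[OF interval_functor_arr[OF F]]
    by auto
  fix M \<mu>
  assume M: "M \<in> functors (interval_cat S) C"
    and mu: "\<mu> \<in> nat_trans (interval_cat P) C (fct_comp (interval_cat P) M (subposet_incl P)) F"
  have mu_arr: "\<mu> z \<in> hom C (FObj M z) (FObj F z)" if "z \<in> P" for z
    using mu that unfolding nat_trans_def restrict_to_subposet interval_cat_simps by simp
  have mu_nat: "Comp C (\<mu> z') (FArr M (z, z')) = Comp C (FArr F (z, z')) (\<mu> z)"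
    if "z \<in> P" "z' \<in> P" "interval_le z z'" for z z'
    using mu that unfolding nat_trans_def restrict_to_subposet interval_cat_simps
    by (cases z, cases z') auto
  have cone: "cone_above C P F x (FObj M x) (\<lambda>z. Comp C (\<mu> z) (FArr M (x, z)))" if x: "x \<in> S" for x
    unfolding cone_above_def
  proof (intro conjI ballI impI)
    show "FObj M x \<in> Obj C" using interval_functor_obj[OF M x] .
    show "Comp C (\<mu> z) (FArr M (x, z)) \<in> hom C (FObj M x) (FObj F z)"
      if "z \<in> P" "interval_le x z" for z
      using that PS by (intro Comp_in_hom[OF interval_functor_arr[OF M x] mu_arr]) auto
    fix z z' assume z: "z \<in> P" "z' \<in> P" "interval_le x z" "interval_le z z'"
    have zS: "z \<in> S" "z' \<in> S" using z PS by auto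
    have Mxz: "FArr M (x, z) \<in> hom C (FObj M x) (FObj M z)"
      using interval_functor_arr[OF M x zS(1) z(3)] .
    have "Comp C (FArr F (z, z')) (Comp C (\<mu> z) (FArr M (x, z)))
        = Comp C (Comp C (\<mu> z') (FArr M (z, z'))) (FArr M (x, z))"
      using Comp_assoc[OF Mxz mu_arr[OF z(1)] interval_functor_arr[OF F z(1,2,4)]] mu_nat[OF z(1,2,4)]
      by simp
    also have "\<dots> = Comp C (\<mu> z') (FArr M (x, z'))"
      using Comp_assoc[OF Mxz interval_functor_arr[OF M zS z(4)] mu_arr[OF z(2)]]
        interval_functor_comp[OF M x zS z(3,4)] by simp
    finally show "Comp C (FArr F (z, z')) (Comp C (\<mu> z) (FArr M (x, z))) = Comp C (\<mu> z') (FArr M (x, z'))" .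
  qed
  have "\<forall>x\<in>S. \<exists>u. u \<in> hom C (FObj M x) (FObj R x) \<and>
      (\<forall>z\<in>P. interval_le x z \<longrightarrow> Comp C (FArr R (x, z)) u = Comp C (\<mu> z) (FArr M (x, z)))"
    using limit_cone_lift[OF lim cone] by metis
  then obtain d where d: "\<And>x. x \<in> S \<Longrightarrow> d x \<in> hom C (FObj M x) (FObj R x)"
    and dz: "\<And>x z. x \<in> S \<Longrightarrow> z \<in> P \<Longrightarrow> interval_le x z \<Longrightarrow>
      Comp C (FArr R (x, z)) (d x) = Comp C (\<mu> z) (FArr M (x, z))"
    by (metis bchoice)
  show "\<exists>!\<delta>. \<delta> \<in> nat_trans (interval_cat S) C M R \<and>
     (\<forall>x\<in>Obj (interval_cat P). Comp C ((\<lambda>z\<in>P. Id C (FObj F z)) x) (\<delta> (FObj (subposet_incl P) x)) = \<mu> x)"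
  proof (intro ex1I[of _ "restrict d S"] conjI)
    have "Comp C (d y) (FArr M (x, y)) = Comp C (FArr R (x, y)) (d x)"
      if xy: "x \<in> S" "y \<in> S" "interval_le x y" for x y
    proof (rule limit_cone_unique[OF lim[OF xy(2)]])
      have Mxy: "FArr M (x, y) \<in> hom C (FObj M x) (FObj M y)"
        and Rxy: "FArr R (x, y) \<in> hom C (FObj R x) (FObj R y)"
        using interval_functor_arr[OF M xy] interval_functor_arr[OF R xy] .
      show "cone_above C P F y (FObj M x) (\<lambda>z. Comp C (\<mu> z) (FArr M (x, z)))"
        using cone[OF xy(1)] xy(3) interval_le_trans unfolding cone_above_def by blast
      show "Comp C (d y) (FArr M (x, y)) \<in> hom C (FObj M x) (FObj R y)"
        by (rule Comp_in_hom[OF Mxy d[OF xy(2)]])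
      show "Comp C (FArr R (x, y)) (d x) \<in> hom C (FObj M x) (FObj R y)"
        by (rule Comp_in_hom[OF d[OF xy(1)] Rxy])
      fix z assume z: "z \<in> P" "interval_le y z"
      then have zS: "z \<in> S" and xz: "interval_le x z" using PS xy interval_le_trans by auto
      have Ryz: "FArr R (y, z) \<in> hom C (FObj R y) (FObj F z)"
        using interval_functor_arr[OF R xy(2) zS z(2)] RFo[OF z(1)] by simp
      have "Comp C (FArr R (y, z)) (Comp C (d y) (FArr M (x, y)))
         = Comp C (Comp C (\<mu> z) (FArr M (y, z))) (FArr M (x, y))"
        using Comp_assoc[OF Mxy d[OF xy(2)] Ryz] dz[OF xy(2) z] by simp
      also have "\<dots> = Comp C (\<mu> z) (FArr M (x, z))"
        using Comp_assoc[OF Mxy interval_functor_arr[OF M xy(2) zS z(2)] mu_arr[OF z(1)]]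
          interval_functor_comp[OF M xy(1,2) zS xy(3) z(2)] by simp
      finally show "Comp C (FArr R (y, z)) (Comp C (d y) (FArr M (x, y))) = Comp C (\<mu> z) (FArr M (x, z))" .
      show "Comp C (FArr R (y, z)) (Comp C (FArr R (x, y)) (d x)) = Comp C (\<mu> z) (FArr M (x, z))"
        using interval_functor_comp_after[OF R xy(1,2) zS xy(3) z(2) d[OF xy(1)]] dz[OF xy(1) z(1) xz]
        by simp
    qed
    then show "restrict d S \<in> nat_trans (interval_cat S) C M R"
      using d unfolding nat_trans_def interval_cat_simps by auto
    show "\<forall>x\<in>Obj (interval_cat P).
       Comp C ((\<lambda>z\<in>P. Id C (FObj F z)) x) (restrict d S (FObj (subposet_incl P) x)) = \<mu> x"
    proof
      fix x assume "x \<in> Obj (interval_cat P)"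
      then have x: "x \<in> P" and xS: "x \<in> S" using PS by (auto simp: interval_cat_simps)
      have "Comp C (FArr R (x, x)) (d x) = Comp C (\<mu> x) (FArr M (x, x))"
        using dz[OF xS x interval_le_refl] .
      then have "d x = \<mu> x"
        using Comp_Id_left[OF d[OF xS]] Comp_Id_right[OF mu_arr[OF x]]
        by (simp add: interval_functor_id[OF R xS] interval_functor_id[OF M xS])
      then show "Comp C ((\<lambda>z\<in>P. Id C (FObj F z)) x) (restrict d S (FObj (subposet_incl P) x)) = \<mu> x"
        using x xS Comp_Id_left[OF mu_arr[OF x]] by (simp add: subposet_incl_def)
    qed
  next
    fix \<delta>
    assume "\<delta> \<in> nat_trans (interval_cat S) C M R \<and>
     (\<forall>x\<in>Obj (interval_cat P). Comp C ((\<lambda>z\<in>P. Id C (FObj F z)) x) (\<delta> (FObj (subposet_incl P) x)) = \<mu> x)"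
    then have nat: "\<delta> \<in> nat_trans (interval_cat S) C M R"
      and \<delta>\<mu>': "\<And>x. x \<in> P \<Longrightarrow> Comp C (Id C (FObj F x)) (\<delta> x) = \<mu> x"
      using PS by (auto simp: interval_cat_simps subposet_incl_def)
    have ext: "\<delta> \<in> extensional S" and \<delta>: "\<And>x. x \<in> S \<Longrightarrow> \<delta> x \<in> hom C (FObj M x) (FObj R x)"
      and \<delta>nat: "\<And>x y. x \<in> S \<Longrightarrow> y \<in> S \<Longrightarrow> interval_le x y \<Longrightarrow>
        Comp C (\<delta> y) (FArr M (x, y)) = Comp C (FArr R (x, y)) (\<delta> x)"
      using nat by (auto simp: nat_trans_def interval_cat_simps)
    have \<delta>\<mu>: "\<delta> z = \<mu> z" if "z \<in> P" for z
      using \<delta>\<mu>'[OF that] Comp_Id_left \<delta>[of z] RFo that PS by auto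
    show "\<delta> = restrict d S"
    proof (rule extensionalityI[OF ext restrict_extensional])
      fix x assume x: "x \<in> S"
      have "\<delta> x = d x"
        using \<delta>nat[OF x] \<delta>\<mu> PS
        by (intro limit_cone_unique[OF lim[OF x] cone[OF x] \<delta>[OF x] _ d[OF x] dz[OF x]])
           (metis subsetD)
      then show "\<delta> x = restrict d S x" using x by simp
    qed
  qed
qed

text \<open>
  A limit cone above \<open>x\<close> restricts to a cone above every larger \<open>y\<close>, and the arrow of \<open>R\<close> from \<open>x\<close> to
  \<open>y\<close> is the map that this cone induces. Functoriality is uniqueness of induced maps.
\<close>

lemma pointwise_extension_exists:
  assumes F: "F \<in> functors (interval_cat P) C" and PS: "P \<subseteq> S"
    and lim: "\<And>x. x \<in> S - P \<Longrightarrow> \<exists>L \<pi>. limit_cone_above C P F x L \<pi>"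
  obtains R where "R \<in> functors (interval_cat S) C"
    and "fct_comp (interval_cat P) R (subposet_incl P) = F"
    and "\<And>x. x \<in> S \<Longrightarrow> limit_cone_above C P F x (FObj R x) (\<lambda>z. FArr R (x, z))"
proof -
  have "\<forall>x\<in>S. \<exists>L. \<exists>\<pi>. limit_cone_above C P F x L \<pi> \<and>
      (x \<in> P \<longrightarrow> L = FObj F x \<and> \<pi> = (\<lambda>z. FArr F (x, z)))"
    using lim limit_cone_at_member[OF F] by (metis DiffI)
  then obtain L where "\<forall>x\<in>S. \<exists>\<pi>. limit_cone_above C P F x (L x) \<pi> \<and>
      (x \<in> P \<longrightarrow> L x = FObj F x \<and> \<pi> = (\<lambda>z. FArr F (x, z)))"
    by (metis bchoice)
  then obtain \<pi> where L: "\<And>x. x \<in> S \<Longrightarrow> limit_cone_above C P F x (L x) (\<pi> x)"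
    and LP: "\<And>x. x \<in> P \<Longrightarrow> L x = FObj F x" "\<And>x z. x \<in> P \<Longrightarrow> \<pi> x z = FArr F (x, z)"
    using PS by (metis (no_types, lifting) bchoice subsetD)
  have Lcone: "cone_above C P F x (L x) (\<pi> x)" if "x \<in> S" for x
    using L[OF that] by (simp add: limit_cone_above_def)
  have Lcone': "cone_above C P F y (L x) (\<pi> x)" if "x \<in> S" "interval_le x y" for x y
    using Lcone[OF that(1)] that(2) interval_le_trans unfolding cone_above_def by blast
  have "\<exists>u. u \<in> hom C (L x) (L y) \<and> (\<forall>z\<in>P. interval_le y z \<longrightarrow> Comp C (\<pi> y z) u = \<pi> x z)"
    if "x \<in> S" "y \<in> S" "interval_le x y" for x y
    using limit_cone_lift[OF L[OF that(2)] Lcone'[OF that(1,3)]] by metis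
  then obtain r where r: "\<And>x y. x \<in> S \<Longrightarrow> y \<in> S \<Longrightarrow> interval_le x y \<Longrightarrow> r x y \<in> hom C (L x) (L y)"
    and rz: "\<And>x y z. x \<in> S \<Longrightarrow> y \<in> S \<Longrightarrow> interval_le x y \<Longrightarrow> z \<in> P \<Longrightarrow> interval_le y z \<Longrightarrow>
      Comp C (\<pi> y z) (r x y) = \<pi> x z"
    by metis
  \<comment> \<open>the tool for all identities below: arrows of the extension are recognised by their legs\<close>
  have runique: "u = r x y"
    if xy: "x \<in> S" "y \<in> S" "interval_le x y" and u: "u \<in> hom C (L x) (L y)"
      and uz: "\<And>z. z \<in> P \<Longrightarrow> interval_le y z \<Longrightarrow> Comp C (\<pi> y z) u = \<pi> x z" for x y u
    by (rule limit_cone_unique[OF L[OF xy(2)] Lcone'[OF xy(1,3)] u uz r[OF xy] rz[OF xy]])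
  have r\<pi>: "r x z = \<pi> x z" if xz: "x \<in> S" "z \<in> P" "interval_le x z" for x z
  proof -
    have "\<pi> x z = r x z"
    proof (rule runique)
      show "\<pi> x z \<in> hom C (L x) (L z)"
        using cone_above_arr[OF Lcone[OF xz(1)] xz(2,3)] LP(1)[OF xz(2)] by simp
      show "Comp C (\<pi> z z') (\<pi> x z) = \<pi> x z'" if "z' \<in> P" "interval_le z z'" for z'
        using cone_above_comp[OF Lcone[OF xz(1)] xz(2) that(1) xz(3) that(2)] LP(2)[OF xz(2)] by simp
    qed (use xz PS in auto)
    then show ?thesis by simp
  qed
  define R :: "('o, 'a) span" where
    "R = \<lparr>FObj = restrict L S, FArr = (\<lambda>a\<in>Arr (interval_cat S). r (fst a) (snd a))\<rparr>"
  have Ro: "FObj R x = L x" if "x \<in> S" for x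
    using that by (simp add: R_def)
  have Ra: "FArr R (x, y) = r x y" if "x \<in> S" "y \<in> S" "interval_le x y" for x y
    using that by (simp add: R_def interval_cat_simps)
  show thesis
  proof
    show "R \<in> functors (interval_cat S) C"
    proof (rule functorsI)
      show "FObj R \<in> extensional (Obj (interval_cat S))" "FArr R \<in> extensional (Arr (interval_cat S))"
        by (simp_all add: R_def interval_cat_simps)
      show "FObj R x \<in> Obj C" if "x \<in> Obj (interval_cat S)" for x
        using that Ro Lcone by (auto simp: interval_cat_simps cone_above_def)
      show "FArr R f \<in> hom C (FObj R (Dom (interval_cat S) f)) (FObj R (Cod (interval_cat S) f))"
        if "f \<in> Arr (interval_cat S)" for f
        using that r Ro Ra by (auto simp: interval_cat_simps)
      show "FArr R (Id (interval_cat S) x) = Id C (FObj R x)" if "x \<in> Obj (interval_cat S)" for x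
      proof -
        have x: "x \<in> S" using that by (simp add: interval_cat_simps)
        have "L x \<in> Obj C" using Lcone[OF x] by (simp add: cone_above_def)
        then have "Id C (L x) = r x x"
          using Id_in_hom Comp_Id_right[OF cone_above_arr[OF Lcone[OF x]]]
          by (intro runique[OF x x interval_le_refl])
        then show ?thesis
          using x by (simp add: interval_cat_simps Ro Ra interval_le_refl)
      qed
      fix f g assume fg: "f \<in> Arr (interval_cat S)" "g \<in> Arr (interval_cat S)"
        "Dom (interval_cat S) g = Cod (interval_cat S) f"
      then obtain x y w where f: "f = (x, y)" and g: "g = (y, w)"
        by (cases f, cases g) (auto simp: interval_cat_simps)
      have S: "x \<in> S" "y \<in> S" "w \<in> S" and le: "interval_le x y" "interval_le y w"
        using fg by (auto simp: f g interval_cat_simps)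
      have le': "interval_le x w" using le interval_le_trans by blast
      have "Comp C (r y w) (r x y) = r x w"
      proof (rule runique[OF S(1,3) le'])
        show "Comp C (r y w) (r x y) \<in> hom C (L x) (L w)"
          using Comp_in_hom r S le by blast
        fix z assume z: "z \<in> P" "interval_le w z"
        have yz: "interval_le y z" using le z interval_le_trans by blast
        show "Comp C (\<pi> w z) (Comp C (r y w) (r x y)) = \<pi> x z"
          using Comp_assoc[OF r[OF S(1,2) le(1)] r[OF S(2,3) le(2)] cone_above_arr[OF Lcone[OF S(3)] z]]
            rz[OF S(2,3) le(2) z] rz[OF S(1,2) le(1) z(1) yz] by simp
      qed
      then show "FArr R (Comp (interval_cat S) g f) = Comp C (FArr R g) (FArr R f)"
        using S le le' by (simp add: interval_cat_simps f g Ra)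
    qed
    have "restrict (FObj R) P = FObj F"
      using F PS LP Ro by (intro extensionalityI[of _ P]) (auto simp: functors_def interval_cat_simps PiE_def)
    moreover have "restrict (FArr R) (Arr (interval_cat P)) = FArr F"
    proof (rule extensionalityI[of _ "Arr (interval_cat P)"])
      show "FArr F \<in> extensional (Arr (interval_cat P))" using F by (simp add: functors_def)
      show "restrict (FArr R) (Arr (interval_cat P)) a = FArr F a" if "a \<in> Arr (interval_cat P)" for a
        using that PS Ra r\<pi> LP(2) by (auto simp: interval_cat_simps subset_iff)
    qed simp
    ultimately show "fct_comp (interval_cat P) R (subposet_incl P) = F"
      by (simp add: restrict_to_subposet)
    show "limit_cone_above C P F x (FObj R x) (\<lambda>z. FArr R (x, z))" if x: "x \<in> S" for x
    proof -
      have "FArr R (x, z) = \<pi> x z" if "z \<in> P" "interval_le x z" for z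
        using that x PS Ra[of x z] r\<pi>[of x z] by auto
      then show ?thesis
        using L[OF x] Ro[OF x] unfolding limit_cone_above_def cone_above_def
        by (smt (verit, ccfv_threshold) interval_le_trans)
    qed
  qed
qed

end


section \<open>Uniqueness of Kan extensions\<close>

text \<open>
  The universal property yields mutually inverse natural transformations between two Kan extensions.
  Their components are isomorphisms, hence identities; so the objects agree, and naturality then says
  that the arrows agree.
\<close>

lemma Kan_extension_unique:
  assumes E: "category E" and D: "category D" and iso: "isos_are_identities E"
    and K: "K \<in> functors C D"
    and R: "is_right_Kan_extension C D E K F R \<epsilon>" and R': "is_right_Kan_extension C D E K F R' \<epsilon>'"
  shows "R = R'"
proof -
  interpret E: category E by (fact E)
  interpret D: category D by (fact D)
  have Kx: "FObj K x \<in> Obj D" if "x \<in> Obj C" for x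
    using functorsD(1)[OF K that] .
  have compat: "\<exists>\<delta>. \<delta> \<in> nat_trans D E R1 R2 \<and> (\<forall>x\<in>Obj C. Comp E (\<epsilon>2 x) (\<delta> (FObj K x)) = \<epsilon>1 x)"
    if "is_right_Kan_extension C D E K F R1 \<epsilon>1" "is_right_Kan_extension C D E K F R2 \<epsilon>2" for R1 R2 \<epsilon>1 \<epsilon>2
    using that unfolding is_right_Kan_extension_def by blast
  \<comment> \<open>stated for an arbitrary pair of extensions, as both composites of the comparison maps are needed\<close>
  have inv: "Comp E (\<delta>' x) (\<delta> x) = Id E (FObj R1 x)"
    if K1: "is_right_Kan_extension C D E K F R1 \<epsilon>1" and K2: "is_right_Kan_extension C D E K F R2 \<epsilon>2"
      and d: "\<delta> \<in> nat_trans D E R1 R2" "\<forall>x\<in>Obj C. Comp E (\<epsilon>2 x) (\<delta> (FObj K x)) = \<epsilon>1 x"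
      and d': "\<delta>' \<in> nat_trans D E R2 R1" "\<forall>x\<in>Obj C. Comp E (\<epsilon>1 x) (\<delta>' (FObj K x)) = \<epsilon>2 x"
      and x: "x \<in> Obj D" for R1 R2 \<epsilon>1 \<epsilon>2 \<delta> \<delta>' x
  proof -
    have R1: "R1 \<in> functors D E" and R2: "R2 \<in> functors D E"
      and e1: "\<epsilon>1 \<in> nat_trans C E (fct_comp C R1 K) F"
      using K1 K2 unfolding is_right_Kan_extension_def by auto
    have e1x: "\<epsilon>1 x \<in> hom E (FObj R1 (FObj K x)) (FObj F x)" if "x \<in> Obj C" for x
      using e1 that by (simp add: nat_trans_def fct_comp_def)
    have dx: "\<delta> x \<in> hom E (FObj R1 x) (FObj R2 x)" and dx': "\<delta>' x \<in> hom E (FObj R2 x) (FObj R1 x)"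
      if "x \<in> Obj D" for x
      using d d' that by (auto simp: nat_trans_def)
    define c i where "c = (\<lambda>x\<in>Obj D. Comp E (\<delta>' x) (\<delta> x))" and "i = (\<lambda>x\<in>Obj D. Id E (FObj R1 x))"
    have "c \<in> nat_trans D E R1 R1"
      unfolding nat_trans_def
    proof (intro CollectI conjI ballI)
      show "c x \<in> hom E (FObj R1 x) (FObj R1 x)" if "x \<in> Obj D" for x
        using that E.Comp_in_hom[OF dx dx'] by (simp add: c_def)
      fix f assume f: "f \<in> Arr D"
      let ?x = "Dom D f" and ?y = "Cod D f"
      have o: "?x \<in> Obj D" "?y \<in> Obj D" using f D.dom_in_Obj D.cod_in_Obj by auto
      have f1: "FArr R1 f \<in> hom E (FObj R1 ?x) (FObj R1 ?y)"
        and f2: "FArr R2 f \<in> hom E (FObj R2 ?x) (FObj R2 ?y)"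
        using functorsD(2)[OF R1 f] functorsD(2)[OF R2 f] .
      have n: "Comp E (\<delta> ?y) (FArr R1 f) = Comp E (FArr R2 f) (\<delta> ?x)"
        "Comp E (\<delta>' ?y) (FArr R2 f) = Comp E (FArr R1 f) (\<delta>' ?x)"
        using d(1) d'(1) f by (auto simp: nat_trans_def)
      have "Comp E (Comp E (\<delta>' ?y) (\<delta> ?y)) (FArr R1 f) = Comp E (\<delta>' ?y) (Comp E (FArr R2 f) (\<delta> ?x))"
        using E.Comp_assoc[OF f1 dx[OF o(2)] dx'[OF o(2)]] n by simp
      also have "\<dots> = Comp E (Comp E (FArr R1 f) (\<delta>' ?x)) (\<delta> ?x)"
        using E.Comp_assoc[OF dx[OF o(1)] f2 dx'[OF o(2)]] n by simp
      also have "\<dots> = Comp E (FArr R1 f) (Comp E (\<delta>' ?x) (\<delta> ?x))"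
        using E.Comp_assoc[OF dx[OF o(1)] dx'[OF o(1)] f1] by simp
      finally show "Comp E (c ?y) (FArr R1 f) = Comp E (FArr R1 f) (c ?x)"
        using o by (simp add: c_def)
    qed (simp add: c_def)
    moreover have "i \<in> nat_trans D E R1 R1"
      unfolding nat_trans_def
      using E.Id_in_hom functorsD(1)[OF R1] functorsD(2)[OF R1] E.Comp_Id_left E.Comp_Id_right
        D.dom_in_Obj D.cod_in_Obj
      by (simp add: i_def) metis
    moreover have "\<forall>x\<in>Obj C. Comp E (\<epsilon>1 x) (c (FObj K x)) = \<epsilon>1 x"
      using d(2) d'(2) E.Comp_assoc[OF dx dx' e1x] Kx by (simp add: c_def)
    moreover have "\<forall>x\<in>Obj C. Comp E (\<epsilon>1 x) (i (FObj K x)) = \<epsilon>1 x"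
      using E.Comp_Id_right[OF e1x] Kx by (simp add: i_def)
    ultimately have "c = i"
      using K1 R1 e1 unfolding is_right_Kan_extension_def by blast
    then show ?thesis
      using x by (metis c_def i_def restrict_apply')
  qed
  obtain d d' where d: "d \<in> nat_trans D E R R'" "\<forall>x\<in>Obj C. Comp E (\<epsilon>' x) (d (FObj K x)) = \<epsilon> x"
    and d': "d' \<in> nat_trans D E R' R" "\<forall>x\<in>Obj C. Comp E (\<epsilon> x) (d' (FObj K x)) = \<epsilon>' x"
    using compat[OF R R'] compat[OF R' R] by blast
  have Rf: "R \<in> functors D E" "R' \<in> functors D E"
    using R R' unfolding is_right_Kan_extension_def by auto
  have dx: "d x \<in> hom E (FObj R x) (FObj R' x)" "d' x \<in> hom E (FObj R' x) (FObj R x)"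
    if "x \<in> Obj D" for x
    using d d' that by (auto simp: nat_trans_def)
  have ident: "FObj R x = FObj R' x \<and> d x = Id E (FObj R x)" if x: "x \<in> Obj D" for x
  proof -
    have "iso_arr E (d x)"
      unfolding iso_arr_def using dx[OF x] inv[OF R R' d d' x] inv[OF R' R d' d x]
      by (auto simp: hom_def)
    then obtain y where "y \<in> Obj E" "d x = Id E y"
      using iso by (auto simp: isos_are_identities_def)
    then show ?thesis
      using dx(1)[OF x] E.Id_in_hom[of y] by (auto simp: hom_def)
  qed
  show "R = R'"
  proof (rule functors_eqI[OF Rf])
    show "FObj R x = FObj R' x" if "x \<in> Obj D" for x
      using ident[OF that] by simp
    fix f assume f: "f \<in> Arr D"
    have o: "Dom D f \<in> Obj D" "Cod D f \<in> Obj D" using f D.dom_in_Obj D.cod_in_Obj by auto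
    have "Comp E (d (Cod D f)) (FArr R f) = Comp E (FArr R' f) (d (Dom D f))"
      using d(1) f by (auto simp: nat_trans_def)
    then show "FArr R f = FArr R' f"
      using E.Comp_Id_left[OF functorsD(2)[OF Rf(1) f]] E.Comp_Id_right[OF functorsD(2)[OF Rf(2) f]]
        ident[OF o(1)] ident[OF o(2)] by simp
  qed
qed

section \<open>Limits over an initial cospan\<close>

text \<open>
  The cospan \<open>l \<rightarrow> c \<leftarrow> r\<close> is an initial subdiagram of the members of \<open>P\<close> above \<open>x\<close>: each such
  \<open>z\<close> lies above \<open>l\<close> or above \<open>r\<close>, and if it lies above both, the two ways are connected through \<open>c\<close>.
  Limits above \<open>x\<close> are then pullbacks.
\<close>

definition initial_cospan_above ::
  "(nat \<times> nat) set \<Rightarrow> nat \<times> nat \<Rightarrow> nat \<times> nat \<Rightarrow> nat \<times> nat \<Rightarrow> nat \<times> nat \<Rightarrow> bool" where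
  "initial_cospan_above P x l r c \<longleftrightarrow>
     l \<in> P \<and> r \<in> P \<and> c \<in> P \<and> interval_le x l \<and> interval_le x r \<and> interval_le l c \<and> interval_le r c \<and>
     (\<forall>z\<in>P. interval_le x z \<longrightarrow>
        (interval_le l z \<or> interval_le r z) \<and> (interval_le l z \<and> interval_le r z \<longrightarrow> interval_le c z))"

context category
begin

context
  fixes P and F :: "('o, 'a) span" and x l r c
  assumes F: "F \<in> functors (interval_cat P) C"
    and cospan: "initial_cospan_above P x l r c"
begin

lemma cospan_arrs:
  "FArr F (l, c) \<in> hom C (FObj F l) (FObj F c)" "FArr F (r, c) \<in> hom C (FObj F r) (FObj F c)"
  using interval_functor_arr[OF F] cospan by (auto simp: initial_cospan_above_def)

text \<open>
  The leg at \<open>z\<close> is obtained from \<open>a\<close> or \<open>b\<close> according to whether \<open>z\<close> lies above \<open>l\<close> or \<open>r\<close>. If it lies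
  above both, the two candidates agree because they factor through \<open>c\<close>.
\<close>

lemma cone_from_cospan:
  assumes a: "a \<in> hom C T (FObj F l)" and b: "b \<in> hom C T (FObj F r)"
    and ab: "Comp C (FArr F (l, c)) a = Comp C (FArr F (r, c)) b"
  obtains \<alpha> where "cone_above C P F x T \<alpha>" "\<alpha> l = a" "\<alpha> r = b"
proof -
  have P: "l \<in> P" "r \<in> P" "c \<in> P" and le: "interval_le x l" "interval_le x r" "interval_le l c" "interval_le r c"
    and init: "\<And>z. z \<in> P \<Longrightarrow> interval_le x z \<Longrightarrow> interval_le l z \<or> interval_le r z"
      "\<And>z. z \<in> P \<Longrightarrow> interval_le x z \<Longrightarrow> interval_le l z \<Longrightarrow> interval_le r z \<Longrightarrow> interval_le c z"
    using cospan by (auto simp: initial_cospan_above_def)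
  define \<alpha> where "\<alpha> z = (if interval_le l z then Comp C (FArr F (l, z)) a else Comp C (FArr F (r, z)) b)" for z
  have \<alpha>l: "\<alpha> z = Comp C (FArr F (l, z)) a" if "interval_le l z" for z
    using that by (simp add: \<alpha>_def)
  have \<alpha>r: "\<alpha> z = Comp C (FArr F (r, z)) b" if z: "z \<in> P" "interval_le r z" for z
  proof (cases "interval_le l z")
    case True
    have cz: "interval_le c z"
      using init(2)[OF z(1) _ True z(2)] le(2) z(2) interval_le_trans by blast
    show ?thesis
      using interval_functor_comp_after[OF F P(1,3) z(1) le(3) cz a]
        interval_functor_comp_after[OF F P(2,3) z(1) le(4) cz b] ab \<alpha>l[OF True] by simp
  qed (simp add: \<alpha>_def)
  show thesis
  proof
    show "cone_above C P F x T \<alpha>"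
      unfolding cone_above_def
    proof (intro conjI ballI impI)
      show "T \<in> Obj C" using hom_Obj a by blast
      show "\<alpha> z \<in> hom C T (FObj F z)" if "z \<in> P" "interval_le x z" for z
        using init(1)[OF that] \<alpha>l[of z] \<alpha>r[of z] that Comp_in_hom[OF a interval_functor_arr[OF F P(1) that(1)]]
          Comp_in_hom[OF b interval_functor_arr[OF F P(2) that(1)]] by auto
      fix z z' assume z: "z \<in> P" "z' \<in> P" "interval_le x z" "interval_le z z'"
      from init(1)[OF z(1,3)] show "Comp C (FArr F (z, z')) (\<alpha> z) = \<alpha> z'"
      proof
        assume lz: "interval_le l z"
        then show ?thesis
          using interval_functor_comp_after[OF F P(1) z(1,2) lz z(4) a] \<alpha>l interval_le_trans[OF lz z(4)]
          by simp
      next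
        assume rz: "interval_le r z"
        then show ?thesis
          using interval_functor_comp_after[OF F P(2) z(1,2) rz z(4) b] \<alpha>r z interval_le_trans[OF rz z(4)]
          by simp
      qed
    qed
    show "\<alpha> l = a"
      using \<alpha>l[OF interval_le_refl] interval_functor_id[OF F P(1)] Comp_Id_left[OF a] by simp
    show "\<alpha> r = b"
      using \<alpha>r[OF P(2) interval_le_refl] interval_functor_id[OF F P(2)] Comp_Id_left[OF b] by simp
  qed
qed

lemma cone_determined_by_cospan:
  assumes \<pi>: "cone_above C P F x L \<pi>" and \<alpha>: "cone_above C P F x T \<alpha>" and u: "u \<in> hom C T L"
  shows "(\<forall>z\<in>P. interval_le x z \<longrightarrow> Comp C (\<pi> z) u = \<alpha> z) \<longleftrightarrow>
    Comp C (\<pi> l) u = \<alpha> l \<and> Comp C (\<pi> r) u = \<alpha> r"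
proof -
  have P: "l \<in> P" "r \<in> P" and le: "interval_le x l" "interval_le x r"
    and init: "\<And>z. z \<in> P \<Longrightarrow> interval_le x z \<Longrightarrow> interval_le l z \<or> interval_le r z"
    using cospan by (auto simp: initial_cospan_above_def)
  have step: "Comp C (\<pi> z) u = \<alpha> z"
    if "Comp C (\<pi> y) u = \<alpha> y" "y \<in> P" "interval_le x y" "z \<in> P" "interval_le y z" for y z
    using that cone_above_comp[OF \<pi> that(2,4,3,5)] cone_above_comp[OF \<alpha> that(2,4,3,5)]
      Comp_assoc[OF u cone_above_arr[OF \<pi> that(2,3)] interval_functor_arr[OF F that(2,4,5)]] by simp
  then show ?thesis
    using P le init by metis
qed

lemma limit_cone_iff_pullback:
  assumes \<pi>: "cone_above C P F x L \<pi>"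
  shows "limit_cone_above C P F x L \<pi> \<longleftrightarrow>
    is_pullback C (FArr F (l, c)) (FArr F (r, c)) L (\<pi> l) (\<pi> r)" (is "?lim \<longleftrightarrow> ?pb")
proof -
  have P: "l \<in> P" "r \<in> P" "c \<in> P" and le: "interval_le x l" "interval_le x r" "interval_le l c" "interval_le r c"
    using cospan by (auto simp: initial_cospan_above_def)
  note pb_iff = is_pullback_iff[OF cospan_arrs]
  have legs: "\<alpha> l \<in> hom C T (FObj F l)" "\<alpha> r \<in> hom C T (FObj F r)"
      "Comp C (FArr F (l, c)) (\<alpha> l) = Comp C (FArr F (r, c)) (\<alpha> r)"
    if "cone_above C P F x T \<alpha>" for T \<alpha>
    using cone_above_arr[OF that] cone_above_comp[OF that] P le by auto
  show ?thesis
  proof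
    assume lim: ?lim
    show ?pb
      unfolding pb_iff
    proof (intro conjI allI impI)
      fix T a b
      assume ab: "a \<in> hom C T (FObj F l)" "b \<in> hom C T (FObj F r)"
        "Comp C (FArr F (l, c)) a = Comp C (FArr F (r, c)) b"
      obtain \<alpha> where \<alpha>: "cone_above C P F x T \<alpha>" "\<alpha> l = a" "\<alpha> r = b"
        using cone_from_cospan[OF ab] .
      have "\<exists>!u. u \<in> hom C T L \<and> (\<forall>z\<in>P. interval_le x z \<longrightarrow> Comp C (\<pi> z) u = \<alpha> z)"
        using lim \<alpha>(1) by (simp add: limit_cone_above_def)
      then show "\<exists>!u. u \<in> hom C T L \<and> Comp C (\<pi> l) u = a \<and> Comp C (\<pi> r) u = b"
        using cone_determined_by_cospan[OF \<pi> \<alpha>(1)] \<alpha>(2,3) by (metis (no_types, lifting))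
    qed (use legs[OF \<pi>] in auto)
  next
    assume pb: ?pb
    show ?lim
      unfolding limit_cone_above_def
    proof (intro conjI allI impI \<pi>)
      fix T \<alpha> assume \<alpha>: "cone_above C P F x T \<alpha>"
      have "\<exists>!u. u \<in> hom C T L \<and> Comp C (\<pi> l) u = \<alpha> l \<and> Comp C (\<pi> r) u = \<alpha> r"
        using pb[unfolded pb_iff] legs[OF \<alpha>] by blast
      then show "\<exists>!u. u \<in> hom C T L \<and> (\<forall>z\<in>P. interval_le x z \<longrightarrow> Comp C (\<pi> z) u = \<alpha> z)"
        using cone_determined_by_cospan[OF \<pi> \<alpha>] by (metis (no_types, lifting))
    qed
  qed
qed

lemma limit_cone_exists:
  assumes "has_pullbacks C"
  obtains L \<pi> where "limit_cone_above C P F x L \<pi>"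
proof -
  obtain L p q where pb: "is_pullback C (FArr F (l, c)) (FArr F (r, c)) L p q"
    using assms cospan_arrs homD unfolding has_pullbacks_def by metis
  then have "p \<in> hom C L (FObj F l)" "q \<in> hom C L (FObj F r)"
    "Comp C (FArr F (l, c)) p = Comp C (FArr F (r, c)) q"
    by (simp_all add: is_pullback_iff[OF cospan_arrs])
  then obtain \<pi> where "cone_above C P F x L \<pi>" "\<pi> l = p" "\<pi> r = q"
    using cone_from_cospan by blast
  with pb show thesis
    using limit_cone_iff_pullback that by blast
qed

end

end


section \<open>Squares in a higher span\<close>

text \<open>
  The square of \<open>R\<close> with initial corner \<open>(v, w)\<close> and terminal corner \<open>(v', w')\<close> is a pullback; it is
  meant for \<open>v \<le> v' \<le> w' \<le> w\<close>.
\<close>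

definition span_square :: "('o, 'a) cat \<Rightarrow> ('o, 'a) span \<Rightarrow> nat \<Rightarrow> nat \<Rightarrow> nat \<Rightarrow> nat \<Rightarrow> bool" where
  "span_square C R v v' w' w \<longleftrightarrow>
     is_pullback C (FArr R ((v, w'), (v', w'))) (FArr R ((v', w), (v', w')))
       (FObj R (v, w)) (FArr R ((v, w), (v, w'))) (FArr R ((v, w), (v', w)))"

context category
begin

lemma pullback_of_identity:
  assumes "g \<in> hom C X Y"
  shows "is_pullback C (Id C Y) g X g (Id C X)" "is_pullback C g (Id C Y) X (Id C X) g"
proof -
  have i: "Id C Y \<in> hom C Y Y" "Id C X \<in> hom C X X"
    using assms hom_Obj Id_in_hom by blast+
  show "is_pullback C (Id C Y) g X g (Id C X)"
    unfolding is_pullback_iff[OF i(1) assms]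
    using i assms Comp_Id_left Comp_Id_right by (metis (no_types, lifting))
  show "is_pullback C g (Id C Y) X (Id C X) g"
    unfolding is_pullback_iff[OF assms i(1)]
    using i assms Comp_Id_left Comp_Id_right by (metis (no_types, lifting))
qed

context
  fixes N and R :: "('o, 'a) span"
  assumes R: "R \<in> spans C N"
begin

lemma span_functor: "R \<in> functors (interval_cat {(v, w). v \<le> w \<and> w \<le> N}) C"
  using R by (simp add: spans_def Sp_def)

lemma span_arr:
  assumes "v \<le> v'" "v' \<le> w'" "w' \<le> w" "w \<le> N"
  shows "FArr R ((v, w), (v', w')) \<in> hom C (FObj R (v, w)) (FObj R (v', w'))"
  using assms by (intro interval_functor_arr[OF span_functor]) (auto simp: interval_le_def)

lemma span_comp_after:
  assumes "v \<le> v'" "v' \<le> v''" "v'' \<le> w''" "w'' \<le> w'" "w' \<le> w" "w \<le> N" "u \<in> hom C T (FObj R (v, w))"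
  shows "Comp C (FArr R ((v', w'), (v'', w''))) (Comp C (FArr R ((v, w), (v', w'))) u)
    = Comp C (FArr R ((v, w), (v'', w''))) u"
  using assms by (intro interval_functor_comp_after[OF span_functor]) (auto simp: interval_le_def)

lemma span_square_commutes:
  assumes "v \<le> v'" "v' \<le> w'" "w' \<le> w" "w \<le> N"
  shows "Comp C (FArr R ((v, w'), (v', w'))) (FArr R ((v, w), (v, w')))
    = Comp C (FArr R ((v', w), (v', w'))) (FArr R ((v, w), (v', w)))"
  using assms interval_functor_comp[OF span_functor, of "(v, w)" "(v, w')" "(v', w')"]
    interval_functor_comp[OF span_functor, of "(v, w)" "(v', w)" "(v', w')"]
  by (auto simp: interval_le_def)

lemma span_square_degenerate:
  assumes "v \<le> v'" "v' \<le> w'" "w' \<le> w" "w \<le> N" "v = v' \<or> w' = w"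
  shows "span_square C R v v' w' w"
proof -
  have id: "FArr R ((a, b), (a, b)) = Id C (FObj R (a, b))" if "a \<le> b" "b \<le> N" for a b
    using that interval_functor_id[OF span_functor, of "(a, b)"] by simp
  show ?thesis
    using assms(5)
  proof
    assume "v = v'"
    then show ?thesis
      using assms pullback_of_identity(1)[OF span_arr[of v v w' w]] by (simp add: span_square_def id)
  next
    assume "w' = w"
    then show ?thesis
      using assms pullback_of_identity(2)[OF span_arr[of v v' w w]] by (simp add: span_square_def id)
  qed
qed

text \<open>
  By hypothesis, and by degeneracy when \<open>v = b\<close> or \<open>w = c\<close>, every \<open>R (v, w)\<close> with \<open>v \<le> b\<close> and \<open>c \<le> w\<close>
  is the pullback of \<open>R (v, c)\<close> and \<open>R (b, w)\<close> over \<open>R (b, c)\<close>. A map into \<open>R (v, w)\<close> is thus a pair of maps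
  into \<open>R (v, c)\<close> and \<open>R (b, w)\<close>. A compatible pair of maps into \<open>R (v, w')\<close> and \<open>R (v', w)\<close> provides such
  a pair, the first through \<open>R (v, w')\<close>, the second through \<open>R (v', w)\<close>.
\<close>

lemma span_square_pasting:
  assumes sq: "\<And>v w. v < b \<Longrightarrow> c < w \<Longrightarrow> w \<le> N \<Longrightarrow> span_square C R v b c w"
    and le: "v \<le> v'" "v' \<le> b" "b \<le> c" "c \<le> w'" "w' \<le> w" "w \<le> N"
  shows "span_square C R v v' w' w"
proof -
  let ?R = "\<lambda>a b c d. FArr R ((a, b), (c, d))"
  have pb: "is_pullback C (?R x c b c) (?R b y b c) (FObj R (x, y)) (?R x y x c) (?R x y b y)"
    if "x \<le> b" "c \<le> y" "y \<le> N" for x y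
    using sq[of x y] span_square_degenerate[of x b c y] that le unfolding span_square_def
    by (metis le_neq_implies_less)
  have monic: "u = u'"
    if "x \<le> b" "c \<le> y" "y \<le> N" "u \<in> hom C T (FObj R (x, y))" "u' \<in> hom C T (FObj R (x, y))"
      "Comp C (?R x y x c) u = Comp C (?R x y x c) u'" "Comp C (?R x y b y) u = Comp C (?R x y b y) u'"
    for x y T u u'
    using pullback_jointly_monic[OF pb[OF that(1-3)] span_arr[of x b c c] span_arr[of b b c y]] that le
    by auto
  have arrs: "?R v w' v' w' \<in> hom C (FObj R (v, w')) (FObj R (v', w'))"
      "?R v' w v' w' \<in> hom C (FObj R (v', w)) (FObj R (v', w'))"
      "?R v w v w' \<in> hom C (FObj R (v, w)) (FObj R (v, w'))"
      "?R v w v' w \<in> hom C (FObj R (v, w)) (FObj R (v', w))"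
    using le by (intro span_arr; simp)+
  show ?thesis
    unfolding span_square_def is_pullback_iff[OF arrs(1,2)]
  proof (intro conjI allI impI arrs(3,4))
    show "Comp C (?R v w' v' w') (?R v w v w') = Comp C (?R v' w v' w') (?R v w v' w)"
      using le by (intro span_square_commutes) auto
    fix T f g
    assume f: "f \<in> hom C T (FObj R (v, w'))" and g: "g \<in> hom C T (FObj R (v', w))"
      and fg: "Comp C (?R v w' v' w') f = Comp C (?R v' w v' w') g"
    \<comment> \<open>\<open>f\<close> and \<open>g\<close> agree on everything beyond \<open>(v', w')\<close>\<close>
    have fg': "Comp C (?R v w' x y) f = Comp C (?R v' w x y) g"
      if "v' \<le> x" "x \<le> y" "y \<le> w'" for x y
      using span_comp_after[of v v' x y w' w' f T] span_comp_after[of v' v' x y w' w g T] fg f g that le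
      by simp
    have f1: "Comp C (?R v w' v c) f \<in> hom C T (FObj R (v, c))"
      and g1: "Comp C (?R v' w b w) g \<in> hom C T (FObj R (b, w))"
      using le by (auto intro!: Comp_in_hom[OF f] Comp_in_hom[OF g] span_arr)
    have "Comp C (?R v c b c) (Comp C (?R v w' v c) f) = Comp C (?R b w b c) (Comp C (?R v' w b w) g)"
      using span_comp_after[of v v b c c w' f T] span_comp_after[of v' b b c w w g T] fg'[of b c] f g le
      by simp
    then obtain u where u: "u \<in> hom C T (FObj R (v, w))"
      and uf: "Comp C (?R v w v c) u = Comp C (?R v w' v c) f"
      and ug: "Comp C (?R v w b w) u = Comp C (?R v' w b w) g"
      using pullback_lift[OF pb[of v w] span_arr[of v b c c] span_arr[of b b c w] f1 g1] le
      by auto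
    show "\<exists>!u. u \<in> hom C T (FObj R (v, w)) \<and> Comp C (?R v w v w') u = f \<and> Comp C (?R v w v' w) u = g"
    proof (intro ex1I[of _ u] conjI u)
      show "Comp C (?R v w v w') u = f"
      proof (rule monic[of v w'])
        show "Comp C (?R v w v w') u \<in> hom C T (FObj R (v, w'))"
          by (rule Comp_in_hom[OF u arrs(3)])
        show "Comp C (?R v w' v c) (Comp C (?R v w v w') u) = Comp C (?R v w' v c) f"
          using span_comp_after[of v v v c w' w u T] u uf le by simp
        have "Comp C (?R v w' b w') (Comp C (?R v w v w') u) = Comp C (?R b w b w') (Comp C (?R v w b w) u)"
          using span_comp_after[of v v b w' w' w u T] span_comp_after[of v b b w' w w u T] u le by simp
        also have "\<dots> = Comp C (?R v w' b w') f"
          using span_comp_after[of v' b b w' w w g T] fg'[of b w'] g ug le by simp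
        finally show "Comp C (?R v w' b w') (Comp C (?R v w v w') u) = Comp C (?R v w' b w') f" .
      qed (use le f in auto)
      show "Comp C (?R v w v' w) u = g"
      proof (rule monic[of v' w])
        show "Comp C (?R v w v' w) u \<in> hom C T (FObj R (v', w))"
          by (rule Comp_in_hom[OF u arrs(4)])
        show "Comp C (?R v' w b w) (Comp C (?R v w v' w) u) = Comp C (?R v' w b w) g"
          using span_comp_after[of v v' b w w w u T] u ug le by simp
        have "Comp C (?R v' w v' c) (Comp C (?R v w v' w) u) = Comp C (?R v c v' c) (Comp C (?R v w v c) u)"
          using span_comp_after[of v v' v' c w w u T] span_comp_after[of v v v' c c w u T] u le by simp
        also have "\<dots> = Comp C (?R v' w v' c) g"
          using span_comp_after[of v v v' c c w' f T] fg'[of v' c] f uf le by simp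
        finally show "Comp C (?R v' w v' c) (Comp C (?R v w v' w) u) = Comp C (?R v' w v' c) g" .
      qed (use le g in auto)
      fix u'
      assume u': "u' \<in> hom C T (FObj R (v, w)) \<and> Comp C (?R v w v w') u' = f \<and> Comp C (?R v w v' w) u' = g"
      show "u' = u"
      proof (rule monic[of v w])
        show "Comp C (?R v w v c) u' = Comp C (?R v w v c) u"
          using span_comp_after[of v v v c w' w u' T] u' uf le by simp
        show "Comp C (?R v w b w) u' = Comp C (?R v w b w) u"
          using span_comp_after[of v v' b w w w u' T] u' ug le by simp
      qed (use le u u' in auto)
    qed
  qed
qed

end

end


section \<open>The simplicial set of higher spans\<close>

lemma fct_comp_in_functors:
  assumes C: "category C" and F: "F \<in> functors C D" and G: "G \<in> functors D E"
  shows "fct_comp C G F \<in> functors C E"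
proof -
  interpret C: category C by (fact C)
  have arr: "FArr F f \<in> Arr D" "Dom D (FArr F f) = FObj F (Dom C f)" "Cod D (FArr F f) = FObj F (Cod C f)"
    if "f \<in> Arr C" for f
    using functorsD(2)[OF F that] by (auto simp: hom_def)
  show ?thesis
  proof (rule functorsI)
    fix f assume f: "f \<in> Arr C"
    show "FArr (fct_comp C G F) f \<in> hom E (FObj (fct_comp C G F) (Dom C f)) (FObj (fct_comp C G F) (Cod C f))"
      using functorsD(2)[OF G arr(1)[OF f]] f arr C.dom_in_Obj C.cod_in_Obj by (simp add: fct_comp_def)
  next
    fix x assume x: "x \<in> Obj C"
    have "Id C x \<in> Arr C" using C.Id_in_hom[OF x] by (simp add: hom_def)
    then show "FArr (fct_comp C G F) (Id C x) = Id E (FObj (fct_comp C G F) x)"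
      using x functorsD(3)[OF F x] functorsD(3)[OF G functorsD(1)[OF F x]] by (simp add: fct_comp_def)
  next
    fix f g assume fg: "f \<in> Arr C" "g \<in> Arr C" "Dom C g = Cod C f"
    have "Comp C g f \<in> Arr C"
      using C.Comp_in_hom[of f "Dom C f" "Cod C f" g "Cod C g"] fg by (simp add: hom_def)
    then show "FArr (fct_comp C G F) (Comp C g f) = Comp E (FArr (fct_comp C G F) g) (FArr (fct_comp C G F) f)"
      using fg functorsD(4)[OF F fg] functorsD(4)[OF G arr(1)[OF fg(1)] arr(1)[OF fg(2)]] arr
      by (simp add: fct_comp_def)
  qed (use functorsD(1)[OF F] functorsD(1)[OF G] in \<open>auto simp: fct_comp_def\<close>)
qed

lemma fct_comp_assoc:
  assumes F: "F \<in> functors C D"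
  shows "fct_comp C (fct_comp D H G) F = fct_comp C H (fct_comp C G F)"
proof -
  have "FArr F f \<in> Arr D" if "f \<in> Arr C" for f
    using functorsD(2)[OF F that] by (simp add: hom_def)
  then show ?thesis
    using functorsD(1)[OF F] by (auto simp: fct_comp_def fun_eq_iff restrict_def)
qed

lemma category_Sp: "category (Sp n)"
  unfolding Sp_def by (rule category_interval_cat)

lemma tw_compose:
  assumes f: "f \<in> simplex_maps l m"
  shows "tw l (compose {..l} g f) = fct_comp (Sp l) (tw m g) (tw l f)"
proof -
  have "f v \<le> f w \<and> f w \<le> m" if "v \<le> w" "w \<le> l" for v w
    using f that by (auto simp: simplex_maps_def mono_on_def)
  then show ?thesis
    by (auto simp: tw_def fct_comp_def compose_def interval_le_def fun_eq_iff)
qed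

lemma span_act_identity:
  assumes "A \<in> spans C n"
  shows "span_act n n (\<lambda>v\<in>{..n}. v) A = A"
proof -
  have "FObj A \<in> extensional (Obj (Sp n))" "FArr A \<in> extensional (Arr (Sp n))"
    using assms by (auto simp: spans_def functors_def PiE_def)
  then have "restrict (FObj A) (Obj (Sp n)) = FObj A" "restrict (FArr A) (Arr (Sp n)) = FArr A"
    by (auto simp: extensional_restrict)
  moreover have "span_act n n (\<lambda>v\<in>{..n}. v) A =
      \<lparr>FObj = restrict (FObj A) (Obj (Sp n)), FArr = restrict (FArr A) (Arr (Sp n))\<rparr>"
    by (auto simp: span_act_def fct_comp_def tw_def interval_le_def fun_eq_iff)
  ultimately show ?thesis
    by simp
qed

lemma simplicial_set_spans: "simplicial_set (spans C) span_act"
proof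
  show "span_act m n f A \<in> spans C m" if "f \<in> simplex_maps m n" "A \<in> spans C n" for f m n A
    using that fct_comp_in_functors[OF category_Sp tw_in_functors[OF that(1)]]
    by (simp only: span_act_def spans_def)
  show "span_act n n (\<lambda>v\<in>{..n}. v) A = A" if "A \<in> spans C n" for n A
    using span_act_identity[OF that] .
  show "span_act l n (compose {..l} g f) A = span_act l m f (span_act m n g A)"
    if f: "f \<in> simplex_maps l m" for f g l m n and A :: "('a, 'b) span"
    unfolding span_act_def tw_compose[OF f] fct_comp_assoc[OF tw_in_functors[OF f]] ..
qed

lemma (in simplicial_set) act_commuting_square:
  assumes "f \<in> simplex_maps a b" "g \<in> simplex_maps b d" "f' \<in> simplex_maps a b'" "g' \<in> simplex_maps b' d"
    and "A \<in> X d" "\<And>v. v \<le> a \<Longrightarrow> g (f v) = g' (f' v)"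
  shows "act a b f (act b d g A) = act a b' f' (act b' d g' A)"
proof -
  have "compose {..a} g f = compose {..a} g' f'"
    using assms(6) by (auto simp: compose_def fun_eq_iff)
  then show ?thesis
    using act_compose[OF assms(1,2,5)] act_compose[OF assms(3,4,5)] by simp
qed


section \<open>Composites are the spans with pullback squares\<close>

text \<open>
  The squares that the pointwise formula for the \<open>k\<close>-composite asks to be pullbacks: their terminal
  corner \<open>(m - k, m)\<close> is the image of the bottom element \<open>(0, k)\<close> of the shared \<open>Sp k\<close>, and their initial corners are
  the elements outside the pushout.
\<close>

definition pullback_across :: "('o, 'a) cat \<Rightarrow> nat \<Rightarrow> nat \<Rightarrow> nat \<Rightarrow> ('o, 'a) span \<Rightarrow> bool" where
  "pullback_across C m k n R \<longleftrightarrow>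
     (\<forall>v w. v < m - k \<longrightarrow> m < w \<longrightarrow> w \<le> m + n - k \<longrightarrow> span_square C R v (m - k) m w)"

lemma span_incl_is_subposet_incl:
  "span_incl m k n = subposet_incl {(v, w). v \<le> w \<and> w \<le> m + n - k \<and> (w \<le> m \<or> m - k \<le> v)}"
  by (simp add: span_incl_def subposet_incl_def span_pushout_def interval_cat_simps)

lemma spans_composable_of_restrictions:
  assumes "k \<le> m" "k \<le> n" and R: "R \<in> spans C (m + n - k)"
  shows "composable (spans C) span_act m k n
    (span_act m (m + n - k) (s_map (m + n - k) m) R) (span_act n (m + n - k) (t_map (m + n - k) n) R)"
proof -
  interpret simplicial_set "spans C" span_act by (rule simplicial_set_spans)
  have s: "s_map (m + n - k) m \<in> simplex_maps m (m + n - k)" and t: "t_map (m + n - k) n \<in> simplex_maps n (m + n - k)"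
    using assms by (auto intro: s_map_in_simplex_maps t_map_in_simplex_maps)
  have "span_act k m (t_map m k) (span_act m (m + n - k) (s_map (m + n - k) m) R)
      = span_act k n (s_map n k) (span_act n (m + n - k) (t_map (m + n - k) n) R)"
    using assms(1,2)
    by (intro act_commuting_square[OF _ s _ t R] t_map_in_simplex_maps s_map_in_simplex_maps)
       (auto simp: s_map_def t_map_def)
  then show ?thesis
    unfolding composable_def using assms act_closed[OF s R] act_closed[OF t R] by blast
qed

lemma restriction_to_pushout:
  assumes "k \<le> m" "k \<le> n" and R: "R \<in> spans C (m + n - k)"
  shows "fct_comp (span_pushout m k n) R (span_incl m k n) = span_cotuple m k n
    (span_act m (m + n - k) (s_map (m + n - k) m) R) (span_act n (m + n - k) (t_map (m + n - k) n) R)"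
proof (rule span_pushout_universal(4)[OF spans_composable_of_restrictions[OF assms]])
  show "fct_comp (span_pushout m k n) R (span_incl m k n) \<in> functors (span_pushout m k n) C"
    using fct_comp_in_functors[OF _ span_incl_legs(1)] R assms category_interval_cat
    unfolding spans_def span_pushout_def by blast
qed (use assms in \<open>simp_all only: span_act_def span_incl_legs(2,3)
      fct_comp_assoc[OF span_pushout_square(1)] fct_comp_assoc[OF span_pushout_square(2)]\<close>)

lemma restrictions_of_cotuple_extension:
  assumes comp: "composable (spans C) span_act m k n A B"
    and R: "fct_comp (span_pushout m k n) R (span_incl m k n) = span_cotuple m k n A B"
  shows "span_act m (m + n - k) (s_map (m + n - k) m) R = A"
    "span_act n (m + n - k) (t_map (m + n - k) n) R = B"
proof -
  have k: "k \<le> m" "k \<le> n" using comp by (auto simp: composable_def)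
  show "span_act m (m + n - k) (s_map (m + n - k) m) R = A"
    "span_act n (m + n - k) (t_map (m + n - k) n) R = B"
    using span_pushout_universal(2,3)[OF comp] unfolding span_act_def R[symmetric]
    by (simp_all only: fct_comp_assoc[OF span_pushout_square(1)[OF k]]
      fct_comp_assoc[OF span_pushout_square(2)[OF k]] span_incl_legs(2,3)[OF k])
qed

context category
begin

lemma initial_cospan_in_pushout:
  assumes "k \<le> m" "k \<le> n" "v < m - k" "m < w" "w \<le> m + n - k"
  shows "initial_cospan_above {(v, w). v \<le> w \<and> w \<le> m + n - k \<and> (w \<le> m \<or> m - k \<le> v)}
    (v, w) (v, m) (m - k, w) (m - k, m)"
  using assms by (auto simp: initial_cospan_above_def interval_le_def)

text \<open>
  On members of the pushout the limit condition is automatic, since there \<open>R\<close> agrees with \<open>F\<close>; at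
  the remaining elements it is the pullback condition on the initial cospan.
\<close>

lemma pointwise_iff_pullback_across:
  fixes m k n
  defines "P \<equiv> {(v, w). v \<le> w \<and> w \<le> m + n - k \<and> (w \<le> m \<or> m - k \<le> v)}"
  assumes k: "k \<le> m" "k \<le> n" and R: "R \<in> spans C (m + n - k)"
    and F: "F \<in> functors (interval_cat P) C" and RF: "fct_comp (interval_cat P) R (subposet_incl P) = F"
  shows "(\<forall>x\<in>{(v, w). v \<le> w \<and> w \<le> m + n - k}. limit_cone_above C P F x (FObj R x) (\<lambda>z. FArr R (x, z)))
    \<longleftrightarrow> pullback_across C m k n R"
proof -
  let ?S = "{(v, w). v \<le> w \<and> w \<le> m + n - k}"
  have PS: "P \<subseteq> ?S" by (auto simp: P_def)
  have Fo: "FObj F z = FObj R z" if "z \<in> P" for z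
    using that by (simp add: RF[symmetric] restrict_to_subposet)
  have Fa: "FArr F (z, z') = FArr R (z, z')" if "z \<in> P" "z' \<in> P" "interval_le z z'" for z z'
    using that by (simp add: RF[symmetric] restrict_to_subposet interval_cat_simps)
  note Rf = span_functor[OF R]
  have cone: "cone_above C P F x (FObj R x) (\<lambda>z. FArr R (x, z))" if x: "x \<in> ?S" for x
    unfolding cone_above_def
    using interval_functor_obj[OF Rf x] interval_functor_arr[OF Rf x] interval_functor_comp[OF Rf x] Fo Fa PS
      subsetD[OF PS]
    by (metis (no_types, lifting))
  have square: "limit_cone_above C P F (v, w) (FObj R (v, w)) (\<lambda>z. FArr R ((v, w), z)) \<longleftrightarrow> span_square C R v (m - k) m w"
    if vw: "v < m - k" "m < w" "w \<le> m + n - k" for v w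
  proof -
    have i: "initial_cospan_above P (v, w) (v, m) (m - k, w) (m - k, m)"
      unfolding P_def by (rule initial_cospan_in_pushout[OF k vw])
    then have "FArr F ((v, m), (m - k, m)) = FArr R ((v, m), (m - k, m))"
      "FArr F ((m - k, w), (m - k, m)) = FArr R ((m - k, w), (m - k, m))"
      unfolding initial_cospan_above_def by (simp_all add: Fa)
    then show ?thesis
      using limit_cone_iff_pullback[OF F i cone] vw by (simp add: span_square_def)
  qed
  have member: "limit_cone_above C P F x (FObj R x) (\<lambda>z. FArr R (x, z))" if "x \<in> P" for x
  proof -
    have "FArr R (x, z) = FArr F (x, z)" if "z \<in> P" "interval_le x z" for z
      using Fa \<open>x \<in> P\<close> that by simp
    moreover have "limit_cone_above C P F x (FObj R x) (\<lambda>z. FArr F (x, z))"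
      using limit_cone_at_member[OF F that] Fo[OF that] by simp
    ultimately show ?thesis
      using cone[of x] that PS unfolding limit_cone_above_def
      by (smt (verit, best) subsetD)
  qed
  show ?thesis
  proof
    assume "\<forall>x\<in>?S. limit_cone_above C P F x (FObj R x) (\<lambda>z. FArr R (x, z))"
    then show "pullback_across C m k n R"
      unfolding pullback_across_def using square by auto
  next
    assume pa: "pullback_across C m k n R"
    show "\<forall>x\<in>?S. limit_cone_above C P F x (FObj R x) (\<lambda>z. FArr R (x, z))"
    proof
      fix x assume x: "x \<in> ?S"
      obtain v w where vw: "x = (v, w)" by fastforce
      show "limit_cone_above C P F x (FObj R x) (\<lambda>z. FArr R (x, z))"
      proof (cases "x \<in> P")
        case False
        then have "v < m - k" "m < w" "w \<le> m + n - k"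
          using x by (auto simp: vw P_def)
        then show ?thesis
          using pa square unfolding pullback_across_def vw by blast
      qed (rule member)
    qed
  qed
qed

lemma pullback_across_is_composite:
  assumes "k \<le> m" "k \<le> n" and R: "R \<in> spans C (m + n - k)" and "pullback_across C m k n R"
  shows "is_span_composite C m k n
    (span_act m (m + n - k) (s_map (m + n - k) m) R) (span_act n (m + n - k) (t_map (m + n - k) n) R) R"
    (is "is_span_composite C m k n ?A ?B R")
proof -
  let ?P = "{(v, w). v \<le> w \<and> w \<le> m + n - k \<and> (w \<le> m \<or> m - k \<le> v)}"
  let ?S = "{(v, w). v \<le> w \<and> w \<le> m + n - k}"
  have F: "span_cotuple m k n ?A ?B \<in> functors (interval_cat ?P) C"
    using span_pushout_universal(1)[OF spans_composable_of_restrictions[OF assms(1-3)]]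
    unfolding span_pushout_def .
  have RF: "fct_comp (interval_cat ?P) R (subposet_incl ?P) = span_cotuple m k n ?A ?B"
    using restriction_to_pushout[OF assms(1-3)] unfolding span_pushout_def span_incl_is_subposet_incl .
  have PS: "?P \<subseteq> ?S" by auto
  have "is_right_Kan_extension (interval_cat ?P) (interval_cat ?S) C (subposet_incl ?P) (span_cotuple m k n ?A ?B) R
    (\<lambda>z\<in>?P. Id C (FObj (span_cotuple m k n ?A ?B) z))"
    using pointwise_iff_pullback_across[OF assms(1-3) F RF] assms(4)
    by (intro pointwise_limits_give_Kan_extension[OF span_functor[OF R] F PS RF]) blast
  then show ?thesis
    unfolding is_span_composite_def span_pushout_def Sp_def span_incl_is_subposet_incl by blast
qed

lemma pullback_across_exists:
  assumes pbs: "has_pullbacks C" and comp: "composable (spans C) span_act m k n A B"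
  obtains R where "R \<in> spans C (m + n - k)" "pullback_across C m k n R"
    "span_act m (m + n - k) (s_map (m + n - k) m) R = A" "span_act n (m + n - k) (t_map (m + n - k) n) R = B"
proof -
  let ?P = "{(v, w). v \<le> w \<and> w \<le> m + n - k \<and> (w \<le> m \<or> m - k \<le> v)}"
  let ?S = "{(v, w). v \<le> w \<and> w \<le> m + n - k}"
  have k: "k \<le> m" "k \<le> n" using comp by (auto simp: composable_def)
  have F: "span_cotuple m k n A B \<in> functors (interval_cat ?P) C"
    using span_pushout_universal(1)[OF comp] unfolding span_pushout_def .
  have PS: "?P \<subseteq> ?S" by auto
  have lim: "\<exists>L \<pi>. limit_cone_above C ?P (span_cotuple m k n A B) x L \<pi>" if "x \<in> ?S - ?P" for x
  proof -
    obtain v w where x: "x = (v, w)" by fastforce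
    have "v < m - k" "m < w" "w \<le> m + n - k"
      using that by (auto simp: x)
    then show ?thesis
      using limit_cone_exists[OF F initial_cospan_in_pushout[OF k] pbs] unfolding x by blast
  qed
  obtain R where R: "R \<in> functors (interval_cat ?S) C"
    and RF: "fct_comp (interval_cat ?P) R (subposet_incl ?P) = span_cotuple m k n A B"
    and limR: "\<And>x. x \<in> ?S \<Longrightarrow>
      limit_cone_above C ?P (span_cotuple m k n A B) x (FObj R x) (\<lambda>z. FArr R (x, z))"
    using pointwise_extension_exists[OF F PS lim] by blast
  have Rs: "R \<in> spans C (m + n - k)"
    using R by (simp only: spans_def Sp_def)
  show thesis
  proof
    show "R \<in> spans C (m + n - k)" by (fact Rs)
    show "pullback_across C m k n R"
      using pointwise_iff_pullback_across[OF k Rs F RF] limR by blast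
    have "fct_comp (span_pushout m k n) R (span_incl m k n) = span_cotuple m k n A B"
      using RF unfolding span_pushout_def span_incl_is_subposet_incl .
    from restrictions_of_cotuple_extension[OF comp this]
    show "span_act m (m + n - k) (s_map (m + n - k) m) R = A" "span_act n (m + n - k) (t_map (m + n - k) n) R = B" .
  qed
qed

lemma span_composite_unique:
  assumes "isos_are_identities C" "k \<le> m" "k \<le> n"
    and "is_span_composite C m k n A B R" "is_span_composite C m k n A B R'"
  shows "R = R'"
  using assms(4,5) Kan_extension_unique[OF category_axioms category_Sp assms(1) span_incl_legs(1)[OF assms(2,3)]]
  unfolding is_span_composite_def by blast

end


section \<open>Reindexing composites\<close>

locale span_category = category C for C :: "('o, 'a) cat" +
  assumes pullbacks: "has_pullbacks C" and isos: "isos_are_identities C"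

sublocale span_category \<subseteq> simplicial_set "spans C" span_act
  by (rule simplicial_set_spans)

context span_category
begin

lemma ex1_span_composite:
  assumes comp: "composable (spans C) span_act m k n A B"
  shows "\<exists>!R. is_span_composite C m k n A B R"
proof -
  have k: "k \<le> m" "k \<le> n" using comp by (auto simp: composable_def)
  show ?thesis
    using pullback_across_exists[OF pullbacks comp] pullback_across_is_composite[OF k]
      span_composite_unique[OF isos k] by metis
qed

lemma span_comp_eqI:
  assumes k: "k \<le> m" "k \<le> n" and N: "N = m + n - k" and R: "R \<in> spans C N" and "pullback_across C m k n R"
    and "span_act m N (s_map N m) R = A" "span_act n N (t_map N n) R = B"
  shows "span_comp C m k n A B = R"
  unfolding span_comp_def
  using pullback_across_is_composite[OF k] assms span_composite_unique[OF isos k]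
  by (intro the_equality) auto

lemma span_comp_properties:
  assumes comp: "composable (spans C) span_act m k n A B"
  shows "span_comp C m k n A B \<in> spans C (m + n - k)"
    "pullback_across C m k n (span_comp C m k n A B)"
    "span_act m (m + n - k) (s_map (m + n - k) m) (span_comp C m k n A B) = A"
    "span_act n (m + n - k) (t_map (m + n - k) n) (span_comp C m k n A B) = B"
proof -
  have k: "k \<le> m" "k \<le> n" using comp by (auto simp: composable_def)
  obtain R where "R \<in> spans C (m + n - k)" "pullback_across C m k n R"
    "span_act m (m + n - k) (s_map (m + n - k) m) R = A" "span_act n (m + n - k) (t_map (m + n - k) n) R = B"
    using pullback_across_exists[OF pullbacks comp] .
  moreover from this have "span_comp C m k n A B = R"
    using span_comp_eqI[OF k refl] by blast
  ultimately show "span_comp C m k n A B \<in> spans C (m + n - k)"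
    "pullback_across C m k n (span_comp C m k n A B)"
    "span_act m (m + n - k) (s_map (m + n - k) m) (span_comp C m k n A B) = A"
    "span_act n (m + n - k) (t_map (m + n - k) n) (span_comp C m k n A B) = B"
    by auto
qed

text \<open>
  The square of \<open>R \<xi>\<close> at \<open>(v, w)\<close> is the square of \<open>R\<close> with corners \<open>(\<xi> v, \<xi> w)\<close> and
  \<open>(\<xi> (m' - k'), \<xi> m')\<close>. The two bounds on \<open>\<xi>\<close> say that its terminal corner
  precedes \<open>(m - k, m)\<close> in the order of intervals, which is what pasting needs.
\<close>

lemma pullback_across_reindex:
  assumes R: "R \<in> spans C (m + n - k)" and pa: "pullback_across C m k n R" and k: "k \<le> m" "k \<le> n"
    and k': "k' \<le> m'" "k' \<le> n'"
    and \<xi>: "\<xi> \<in> simplex_maps (m' + n' - k') (m + n - k)" and ends: "\<xi> (m' - k') \<le> m - k" "m \<le> \<xi> m'"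
  shows "pullback_across C m' k' n' (span_act (m' + n' - k') (m + n - k) \<xi> R)"
  unfolding pullback_across_def
proof (intro allI impI)
  fix v w assume vw: "v < m' - k'" "m' < w" "w \<le> m' + n' - k'"
  have mono: "\<xi> a \<le> \<xi> b" "\<xi> b \<le> m + n - k" if "a \<le> b" "b \<le> m' + n' - k'" for a b
    using \<xi> that by (auto simp: simplex_maps_def mono_on_def)
  have "span_square C R (\<xi> v) (\<xi> (m' - k')) (\<xi> m') (\<xi> w)"
  proof (rule span_square_pasting[OF R])
    show "span_square C R x (m - k) m y" if "x < m - k" "m < y" "y \<le> m + n - k" for x y
      using pa that by (simp add: pullback_across_def)
  qed (use ends vw mono in auto)
  moreover have "FObj (span_act (m' + n' - k') (m + n - k) \<xi> R) (a, b) = FObj R (\<xi> a, \<xi> b)"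
    if "a \<le> b" "b \<le> m' + n' - k'" for a b
    using that by (simp add: span_act_def fct_comp_def tw_def)
  moreover have "FArr (span_act (m' + n' - k') (m + n - k) \<xi> R) ((a, b), (c, d)) = FArr R ((\<xi> a, \<xi> b), (\<xi> c, \<xi> d))"
    if "a \<le> c" "c \<le> d" "d \<le> b" "b \<le> m' + n' - k'" for a b c d
    using that by (simp add: span_act_def fct_comp_def tw_def interval_le_def)
  ultimately show "span_square C (span_act (m' + n' - k') (m + n - k) \<xi> R) v (m' - k') m' w"
    unfolding span_square_def using vw k' by simp
qed

text \<open>
  When \<open>\<xi>\<close> glues an operator \<open>\<alpha>\<close> on \<open>A\<close> with an operator \<open>\<beta>\<close> on \<open>B\<close>, the faces of the reindexed composite are
  \<open>A \<alpha>\<close> and \<open>B \<beta>\<close>. The conditions \<open>\<alpha> m' = m\<close> and \<open>\<beta> 0 = 0\<close> keep the overlap in place, that is, they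
  give \<open>\<xi> m' = m\<close> and \<open>\<xi> (m' - k') = m - k\<close>. This covers all degeneracies and faces.
\<close>

lemma span_comp_reindex:
  assumes comp: "composable (spans C) span_act m k n A B"
    and k': "k' \<le> m'" "k' \<le> n'" and N': "N' = m' + n' - k'" and \<xi>: "\<xi> \<in> simplex_maps N' (m + n - k)"
    and \<alpha>: "\<alpha> \<in> simplex_maps m' m" and \<beta>: "\<beta> \<in> simplex_maps n' n"
    and \<xi>\<alpha>: "\<And>v. v \<le> m' \<Longrightarrow> \<xi> v = \<alpha> v" and \<xi>\<beta>: "\<And>v. v \<le> n' \<Longrightarrow> \<xi> (v + (m' - k')) = \<beta> v + (m - k)"
    and ends: "\<alpha> m' = m" "\<beta> 0 = 0"
  shows "span_act N' (m + n - k) \<xi> (span_comp C m k n A B)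
    = span_comp C m' k' n' (span_act m' m \<alpha> A) (span_act n' n \<beta> B)"
proof -
  let ?R = "span_comp C m k n A B"
  have k: "k \<le> m" "k \<le> n" using comp by (auto simp: composable_def)
  note props = span_comp_properties[OF comp]
  have range: "\<alpha> v \<le> m" if "v \<le> m'" for v using \<alpha> that by (auto simp: simplex_maps_def)
  have range': "\<beta> v \<le> n" if "v \<le> n'" for v using \<beta> that by (auto simp: simplex_maps_def)
  have "span_comp C m' k' n' (span_act m' m \<alpha> A) (span_act n' n \<beta> B) = span_act N' (m + n - k) \<xi> ?R"
  proof (rule span_comp_eqI[OF k' N'])
    show "span_act N' (m + n - k) \<xi> ?R \<in> spans C N'"
      by (rule act_closed[OF \<xi> props(1)])
    show "pullback_across C m' k' n' (span_act N' (m + n - k) \<xi> ?R)"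
      using \<xi> \<xi>\<alpha>[of m'] \<xi>\<beta>[of 0] ends unfolding N'
      by (intro pullback_across_reindex[OF props(1,2) k k']) auto
    have "span_act m' N' (s_map N' m') (span_act N' (m + n - k) \<xi> ?R)
      = span_act m' m \<alpha> (span_act m (m + n - k) (s_map (m + n - k) m) ?R)"
      using k k' N' \<xi>\<alpha> range
      by (intro act_commuting_square[OF _ \<xi> \<alpha> _ props(1)] s_map_in_simplex_maps) (auto simp: s_map_def)
    then show "span_act m' N' (s_map N' m') (span_act N' (m + n - k) \<xi> ?R) = span_act m' m \<alpha> A"
      by (simp add: props(3))
    have "N' - n' = m' - k'" "m + n - k - n = m - k" using k k' N' by auto
    then have "span_act n' N' (t_map N' n') (span_act N' (m + n - k) \<xi> ?R)
      = span_act n' n \<beta> (span_act n (m + n - k) (t_map (m + n - k) n) ?R)"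
      using k k' N' \<xi>\<beta> range'
      by (intro act_commuting_square[OF _ \<xi> \<beta> _ props(1)] t_map_in_simplex_maps) (auto simp: t_map_def)
    then show "span_act n' N' (t_map N' n') (span_act N' (m + n - k) \<xi> ?R) = span_act n' n \<beta> B"
      by (simp add: props(4))
  qed
  then show ?thesis by simp
qed

text \<open>
  Reindexing along the identity: a composite along \<open>k\<close> is also a composite along any overlap
  that contains the original one. This covers both back-and-forth laws.
\<close>

lemma span_comp_resplit:
  assumes comp: "composable (spans C) span_act m k n A B"
    and k': "k' \<le> m'" "k' \<le> n'" and N': "m' + n' - k' = m + n - k" and ends: "m' - k' \<le> m - k" "m \<le> m'"
  shows "span_comp C m' k' n'
      (span_act m' (m + n - k) (s_map (m + n - k) m') (span_comp C m k n A B))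
      (span_act n' (m + n - k) (t_map (m + n - k) n') (span_comp C m k n A B))
    = span_comp C m k n A B"
proof -
  let ?N = "m + n - k" and ?R = "span_comp C m k n A B"
  have k: "k \<le> m" "k \<le> n" using comp by (auto simp: composable_def)
  note props = span_comp_properties[OF comp]
  let ?i = "\<lambda>v\<in>{..?N}. v"
  have "m' \<le> ?N" using N' k' by simp
  then have "pullback_across C m' k' n' (span_act (m' + n' - k') ?N ?i ?R)"
    using ends unfolding N'
    by (intro pullback_across_reindex[OF props(1,2) k k', unfolded N'])
       (auto simp: simplex_maps_def mono_on_def)
  then have "pullback_across C m' k' n' ?R"
    by (simp add: N' act_id[OF props(1)])
  then show ?thesis
    by (intro span_comp_eqI[OF k' N'[symmetric] props(1)]) auto
qed

lemma compository_spans: "compository (spans C) span_act (span_comp C)"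
proof
  show "span_comp C m k n A B \<in> spans C (m + n - k)" if "composable (spans C) span_act m k n A B" for m k n A B
    using span_comp_properties(1)[OF that] .
  show "span_comp C k k m (span_act k m (s_map m k) A) A = A" if "k \<le> m" "A \<in> spans C m" for k m A
    using that act_id[OF that(2)]
    by (intro span_comp_eqI[where N = m]) (auto simp: pullback_across_def t_map_def)
  show "span_comp C m k k A (span_act k m (t_map m k) A) = A" if "k \<le> m" "A \<in> spans C m" for k m A
    using that act_id[OF that(2)]
    by (intro span_comp_eqI[where N = m]) (auto simp: pullback_across_def s_map_def)
  fix m k n i and A B :: "('o, 'a) span"
  assume comp: "composable (spans C) span_act m k n A B"
  have k: "k \<le> m" "k \<le> n" and A: "A \<in> spans C m" and B: "B \<in> spans C n"
    using comp by (auto simp: composable_def)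
  note idA = act_id[OF A] and idB = act_id[OF B]
  have id: "(\<lambda>v\<in>{..l}. v) \<in> simplex_maps l l" for l
    by (auto simp: simplex_maps_def mono_on_def)
  show "span_comp C (m + i) (k + i) n
      (span_act (m + i) (m + n - k) (s_map (m + n - k) (m + i)) (span_comp C m k n A B)) B
    = span_comp C m k n A B" if "i \<le> n - k"
    using span_comp_resplit[OF comp, of "k + i" "m + i" n] span_comp_properties(4)[OF comp] that k by simp
  show "span_comp C m (k + i) (n + i) A
      (span_act (n + i) (m + n - k) (t_map (m + n - k) (n + i)) (span_comp C m k n A B))
    = span_comp C m k n A B" if "i \<le> m - k"
    using span_comp_resplit[OF comp, of "k + i" m "n + i"] span_comp_properties(3)[OF comp] that k by simp
  show "span_act (m + n - k + 1) (m + n - k) (degen_map (m + n - k) i) (span_comp C m k n A B)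
    = span_comp C (m + 1) k n (span_act (m + 1) m (degen_map m i) A) B" if "i \<le> m - k"
    using that k
    by (intro span_comp_reindex[OF comp, where n' = n and \<beta> = "\<lambda>v\<in>{..n}. v", unfolded idB]
        degen_map_in_simplex_maps id) (auto simp: degen_map_def)
  show "span_act (m + n - k + 1) (m + n - k) (degen_map (m + n - k) i) (span_comp C m k n A B)
    = span_comp C m k (n + 1) A (span_act (n + 1) n (degen_map n (i + k - m)) B)"
    if "m \<le> i" "i \<le> m + n - k"
    using that k
    by (intro span_comp_reindex[OF comp, where m' = m and \<alpha> = "\<lambda>v\<in>{..m}. v", unfolded idA]
        degen_map_in_simplex_maps id) (auto simp: degen_map_def)
  show "span_act (m + n - k + 1) (m + n - k) (degen_map (m + n - k) i) (span_comp C m k n A B)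
    = span_comp C (m + 1) (k + 1) (n + 1)
       (span_act (m + 1) m (degen_map m i) A) (span_act (n + 1) n (degen_map n (i + k - m)) B)"
    if "m - k \<le> i" "i \<le> m"
    using that k
    by (intro span_comp_reindex[OF comp] degen_map_in_simplex_maps) (auto simp: degen_map_def)
  show "span_act (m + n - k - 1) (m + n - k) (face_map (m + n - k) i) (span_comp C m k n A B)
    = span_comp C (m - 1) k n (span_act (m - 1) m (face_map m i) A) B" if "i < m - k"
    using that k
    by (intro span_comp_reindex[OF comp, where n' = n and \<beta> = "\<lambda>v\<in>{..n}. v", unfolded idB]
        face_map_in_simplex_maps id) (auto simp: face_map_def)
  show "span_act (m + n - k - 1) (m + n - k) (face_map (m + n - k) i) (span_comp C m k n A B)
    = span_comp C m k (n - 1) A (span_act (n - 1) n (face_map n (i + k - m)) B)"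
    if "m < i" "i \<le> m + n - k"
    using that k
    by (intro span_comp_reindex[OF comp, where m' = m and \<alpha> = "\<lambda>v\<in>{..m}. v", unfolded idA]
        face_map_in_simplex_maps id) (auto simp: face_map_def)
qed

end

theorem theorem3p2p4:
  fixes C :: "('o, 'a) cat"
  assumes "category C"
    and "has_pullbacks C"
    and "isos_are_identities C"
  shows "(\<forall>m k n A B. composable (spans C) span_act m k n A B \<longrightarrow>
            (\<exists>!R. is_span_composite C m k n A B R)) \<and>
         compository (spans C) span_act (span_comp C)"
proof -
  interpret span_category C
    by (intro span_category.intro span_category_axioms.intro assms)
  show ?thesis
    using ex1_span_composite compository_spans by blast
qed

end
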